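(* Let $p_d$ denote the number of isomorphism classes of perfect $d$-dimensional primitive integral lattices (equivalently, the number of similarity classes of perfect $d$-dimensional Euclidean lattices). For every $\epsilon>0$ there exists $N(\epsilon)$ such that for all $d\ge N(\epsilon)$, $$e^{d^{1-\epsilon}}<p_d<e^{d^{3+\epsilon}}.$$
   Context: A lattice is a discrete subgroup $\Lambda$ of a Euclidean vector space; its dimension (rank) is $d=\dim(\Lambda\otimes_{\mathbb Z}\mathbb R)$. $\Lambda_{\min}$ denotes the set of nonzero vectors of $\Lambda$ of minimal length. $\Lambda$ is perfect if the tensors $\{v\otimes v\}_{v\in\Lambda_{\min}}$ span the full $\binom{d+1}{2}$-dimensional space of symmetric tensors in $(\Lambda\otimes\mathbb R)\otimes_{\mathbb R}(\Lambda\otimes\mathbb R)$. A lattice is primitive integral if all scalar products of its elements are integers and the set of all these scalar products has greatest common divisor $1$. *)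

theory Defs
  imports Complex_Main
begin

text \<open>Vectors of R^d are modelled as functions nat => real vanishing from index d on.
  Every d-dimensional lattice is isometric to a full-rank lattice in R^d, so we
  work with full-rank lattices in R^d.\<close>

definition is_vec :: "nat \<Rightarrow> (nat \<Rightarrow> real) \<Rightarrow> bool" where
  "is_vec d x \<longleftrightarrow> (\<forall>i\<ge>d. x i = 0)"

definition ip :: "nat \<Rightarrow> (nat \<Rightarrow> real) \<Rightarrow> (nat \<Rightarrow> real) \<Rightarrow> real" where
  "ip d x y = (\<Sum>i<d. x i * y i)"

definition lattice_of :: "nat \<Rightarrow> (nat \<Rightarrow> nat \<Rightarrow> real) \<Rightarrow> (nat \<Rightarrow> real) set" where
  "lattice_of d b = {x. \<exists>c::nat \<Rightarrow> int. x = (\<lambda>i. \<Sum>j<d. of_int (c j) * b j i)}"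

definition is_lattice :: "nat \<Rightarrow> (nat \<Rightarrow> real) set \<Rightarrow> bool" where
  "is_lattice d L \<longleftrightarrow> (\<exists>b. (\<forall>j<d. is_vec d (b j)) \<and>
     (\<forall>c::nat \<Rightarrow> real. (\<lambda>i. \<Sum>j<d. c j * b j i) = (\<lambda>i. 0) \<longrightarrow> (\<forall>j<d. c j = 0)) \<and>
     L = lattice_of d b)"

definition min_vecs :: "nat \<Rightarrow> (nat \<Rightarrow> real) set \<Rightarrow> (nat \<Rightarrow> real) set" where
  "min_vecs d L = {v \<in> L. v \<noteq> (\<lambda>i. 0) \<and> (\<forall>w\<in>L. w \<noteq> (\<lambda>i. 0) \<longrightarrow> ip d v v \<le> ip d w w)}"

text \<open>Perfect: the tensors v \<otimes> v (v minimal) span the space of symmetric d x d tensors,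
  i.e. every symmetric d x d real matrix is a real linear combination of them
  (the set of minimal vectors of a lattice is finite).\<close>
definition perfect :: "nat \<Rightarrow> (nat \<Rightarrow> real) set \<Rightarrow> bool" where
  "perfect d L \<longleftrightarrow> (\<forall>S::nat \<Rightarrow> nat \<Rightarrow> real. (\<forall>i<d. \<forall>j<d. S i j = S j i) \<longrightarrow>
     (\<exists>a::(nat \<Rightarrow> real) \<Rightarrow> real. \<forall>i<d. \<forall>j<d.
        S i j = (\<Sum>v\<in>min_vecs d L. a v * v i * v j)))"

definition prim_integral :: "nat \<Rightarrow> (nat \<Rightarrow> real) set \<Rightarrow> bool" where
  "prim_integral d L \<longleftrightarrow> (\<forall>x\<in>L. \<forall>y\<in>L. ip d x y \<in> \<int>) \<and>
     Gcd {k::int. \<exists>x\<in>L. \<exists>y\<in>L. ip d x y = of_int k} = 1"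

definition lattice_iso :: "nat \<Rightarrow> (nat \<Rightarrow> real) set \<Rightarrow> (nat \<Rightarrow> real) set \<Rightarrow> bool" where
  "lattice_iso d L L' \<longleftrightarrow> (\<exists>U::nat \<Rightarrow> nat \<Rightarrow> real.
     (\<forall>i<d. \<forall>j<d. (\<Sum>k<d. U k i * U k j) = (if i = j then 1 else 0)) \<and>
     L' = (\<lambda>x. \<lambda>i. if i < d then (\<Sum>k<d. U i k * x k) else 0) ` L)"

definition perfect_prim_lattices :: "nat \<Rightarrow> (nat \<Rightarrow> real) set set" where
  "perfect_prim_lattices d = {L. is_lattice d L \<and> perfect d L \<and> prim_integral d L}"

definition p_count :: "nat \<Rightarrow> nat" where
  "p_count d = card (perfect_prim_lattices d //
     {(L, L'). L \<in> perfect_prim_lattices d \<and> L' \<in> perfect_prim_lattices d \<and> lattice_iso d L L'})"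

end

(*
  Upper bound. Choosing d minimal vectors of maximal determinant, all minimal vectors have
  coordinates in [-1,1] with respect to them. Two lattice points in a common cell of side 1/(d+1)
  would differ by a vector shorter than the minimum, so the lattice has at most K = (2d+3)^d points
  in the coordinate cube and its coordinates have denominators at most K. A perfect lattice is
  determined up to similarity by d generators modulo the chosen vectors (K^(2 d^2) choices) and by
  the coordinates of d^2 minimal vectors whose tensors span (K^(d^2) choices).

  Lower bound. For a set S of d points of F_2^n, take the integer vectors on S whose reduction
  modulo 2 is orthogonal to all affine functions on F_2^n. If every pair of points lies in many
  quadruples of S with sum zero, then the minimal vectors are +-2e_i and the vectors with entries
  +-1 on such a quadruple; the lattice is perfect because each pair lies in a quadruple. The +-2e_i
  are the minimal vectors with even inner product against the whole lattice, so an isomorphism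
  induces a bijection of point sets that respects sums of three points. Such a map is determined by
  its values on n+1 points, whereas there are at least 2^(d/2) suitable sets S in F_2^n with 2^n
  between 2d and 4d.
*)
theory Submission
  imports Defs "Jordan_Normal_Form.Determinant" "HOL-Library.FuncSet" "HOL-Real_Asymp.Real_Asymp"
begin

section \<open>Linear algebra\<close>

text \<open>The data counted for the upper bound fix a lattice only up to scaling. Primitivity
  removes the scale: two proportional sets of integers that both have gcd 1 differ by the factor 1.
  With \<open>K = (2*d+3)^d\<close>, the \<open>K^(3*d^2)\<close> choices give the exponent
  \<open>3*d^3*ln (2*d+3)\<close>, whose logarithm is absorbed by the \<epsilon>. For the lower
  bound, richness in quadruples is forced by putting a fixed core into every S: the union of two
  coordinate subspaces of codimension 4 that together span F_2^n. The core has at most 2^n/8, hence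
  at most d/2, points, so at least half of S stays free, which gives 2^(d/2). The core is also what
  makes a map that respects only those sums of three points that stay in S depend on n+1 values
  alone. This costs a factor (2^n)^(n+1), the exponential of O((log d)^2), negligible against
  2^(d/2). Since \<open>card\<close> of an infinite set is 0, the lower bound needs the finiteness
  of the set of classes, which comes from the upper bound.\<close>

definition lincomb :: "nat \<Rightarrow> (nat \<Rightarrow> nat \<Rightarrow> real) \<Rightarrow> (nat \<Rightarrow> real) \<Rightarrow> nat \<Rightarrow> real" where
  "lincomb d v t = (\<lambda>i. \<Sum>j<d. t j * v j i)"

text \<open>Both orders of the matrix inverse are recorded: the first reads coordinates off a
  combination (\<open>dual_basis_coord\<close>), the second rebuilds a vector from its coordinates
  (\<open>dual_basis_lincomb\<close>).\<close>

definition dual_basis :: "nat \<Rightarrow> (nat \<Rightarrow> nat \<Rightarrow> real) \<Rightarrow> (nat \<Rightarrow> nat \<Rightarrow> real) \<Rightarrow> bool" where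
  "dual_basis d v u \<longleftrightarrow>
     (\<forall>j<d. \<forall>l<d. (\<Sum>i<d. u j i * v l i) = (if j = l then 1 else 0)) \<and>
     (\<forall>i<d. \<forall>k<d. (\<Sum>l<d. u l i * v l k) = (if i = k then 1 else 0))"

definition coord_mat :: "nat \<Rightarrow> (nat \<Rightarrow> nat \<Rightarrow> real) \<Rightarrow> real mat" where
  "coord_mat d v = mat d d (\<lambda>(i, j). v j i)"

lemma coord_mat_carrier [simp]: "coord_mat d v \<in> carrier_mat d d"
  by (simp add: coord_mat_def)

text \<open>Passing to the transpose makes the kernel vector a linear functional that vanishes on
  every \<open>v j\<close>, which contradicts spanning in \<open>auerbach_basis\<close>.\<close>

lemma det_coord_mat_eq_0:
  assumes "det (coord_mat d v) = 0"
  shows "\<exists>y. (\<exists>i<d. y i \<noteq> 0) \<and> (\<forall>j<d. (\<Sum>i<d. y i * v j i) = 0)"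
proof -
  have "det (transpose_mat (coord_mat d v)) = 0"
    using assms det_transpose[OF coord_mat_carrier] by metis
  then obtain x where x: "x \<in> carrier_vec d" "x \<noteq> 0\<^sub>v d" "transpose_mat (coord_mat d v) *\<^sub>v x = 0\<^sub>v d"
    using det_0_iff_vec_prod_zero_field[of "transpose_mat (coord_mat d v)" d] by auto
  have "\<exists>i<d. x $ i \<noteq> 0" using x(1,2) by (metis carrier_vecD eq_vecI index_zero_vec)
  moreover have "(\<Sum>i<d. x $ i * v j i) = 0" if "j < d" for j
  proof -
    have "(transpose_mat (coord_mat d v) *\<^sub>v x) $ j = 0" using x(3) that by simp
    then show ?thesis using that x(1)
      by (simp add: coord_mat_def scalar_prod_def mult.commute lessThan_atLeast0)
  qed
  ultimately show ?thesis by blast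
qed

lemma dual_basis_exists:
  assumes "det (coord_mat d v) \<noteq> 0"
  shows "\<exists>u. dual_basis d v u"
proof -
  let ?A = "coord_mat d v"
  have "?A \<in> Units (ring_mat TYPE(real) d ())" by (rule det_non_zero_imp_unit[OF _ assms]) simp
  then obtain B where B: "B \<in> carrier_mat d d" "B * ?A = 1\<^sub>m d" "?A * B = 1\<^sub>m d"
    unfolding Units_def ring_mat_def by auto
  have 1: "(\<Sum>i<d. B $$ (j, i) * v l i) = (if j = l then 1 else 0)" if "j < d" "l < d" for j l
  proof -
    have "(B * ?A) $$ (j, l) = (if j = l then 1 else 0)" using B(2) that by simp
    then show ?thesis using that B(1)
      by (simp add: coord_mat_def scalar_prod_def lessThan_atLeast0)
  qed
  have 2: "(\<Sum>l<d. B $$ (l, i) * v l k) = (if i = k then 1 else 0)" if "i < d" "k < d" for i k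
  proof -
    have "(?A * B) $$ (k, i) = (if k = i then 1 else 0)" using B(3) that by simp
    then show ?thesis using that B(1)
      by (auto simp add: coord_mat_def scalar_prod_def lessThan_atLeast0 mult.commute)
  qed
  show ?thesis unfolding dual_basis_def
    by (rule exI[of _ "\<lambda>j i. B $$ (j, i)"]) (use 1 2 in blast)
qed

lemma cramer_coord_mat:
  assumes "k < d" and "\<And>i. i < d \<Longrightarrow> w i = lincomb d v t i"
  shows "det (coord_mat d (v(k := w))) = t k * det (coord_mat d v)"
proof -
  have "replace_col (coord_mat d v) (coord_mat d v *\<^sub>v vec d t) k = coord_mat d (v(k := w))"
    using assms
    by (auto intro!: eq_matI simp: replace_col_def coord_mat_def scalar_prod_def lincomb_def
        lessThan_atLeast0 mult.commute)
  then show ?thesis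
    using cramer_lemma_mat[OF coord_mat_carrier, of "vec d t" d k v] assms(1) by simp
qed

lemma dual_basis_lincomb:
  assumes "dual_basis d v u" "i < d"
  shows "lincomb d v (\<lambda>j. \<Sum>k<d. u j k * x k) i = x i"
proof -
  have "lincomb d v (\<lambda>j. \<Sum>k<d. u j k * x k) i = (\<Sum>j<d. \<Sum>k<d. x k * (u j k * v j i))"
    unfolding lincomb_def by (simp add: sum_distrib_left sum_distrib_right mult_ac)
  also have "\<dots> = (\<Sum>k<d. x k * (\<Sum>j<d. u j k * v j i))"
    by (subst sum.swap) (simp add: sum_distrib_left)
  also have "\<dots> = (\<Sum>k<d. x k * (if k = i then 1 else 0))"
    by (rule sum.cong) (use assms in \<open>auto simp: dual_basis_def\<close>)
  also have "\<dots> = x i" using assms(2) by (simp add: if_distrib[of "(*) _"] cong: if_cong)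
  finally show ?thesis .
qed

lemma dual_basis_coord:
  assumes "dual_basis d v u" "j < d"
  shows "(\<Sum>k<d. u j k * lincomb d v t k) = t j"
proof -
  have "(\<Sum>k<d. u j k * lincomb d v t k) = (\<Sum>k<d. \<Sum>l<d. t l * (u j k * v l k))"
    unfolding lincomb_def by (simp add: sum_distrib_left mult_ac)
  also have "\<dots> = (\<Sum>l<d. t l * (\<Sum>k<d. u j k * v l k))"
    by (subst sum.swap) (simp add: sum_distrib_left)
  also have "\<dots> = (\<Sum>l<d. t l * (if j = l then 1 else 0))"
    by (rule sum.cong) (use assms in \<open>auto simp: dual_basis_def\<close>)
  also have "\<dots> = t j" using assms(2) by (simp add: if_distrib[of "(*) _"] cong: if_cong)
  finally show ?thesis .
qed

text \<open>Gaussian elimination: if some functional involves the coordinate \<open>i\<close>, subtract multiples of it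
  from all others to eliminate that coordinate.\<close>

lemma small_separating_subset:
  fixes W :: "'w set" and w :: "'w \<Rightarrow> 'i \<Rightarrow> real"
  assumes "finite I"
  shows "\<exists>W0\<subseteq>W. finite W0 \<and> card W0 \<le> card I \<and>
    (\<forall>x. (\<forall>a\<in>W0. (\<Sum>i\<in>I. w a i * x i) = 0) \<longrightarrow> (\<forall>a\<in>W. (\<Sum>i\<in>I. w a i * x i) = 0))"
  using assms
proof (induction I arbitrary: w rule: finite_induct)
  case empty
  then show ?case by (intro exI[of _ "{}"]) auto
next
  case (insert i I)
  show ?case
  proof (cases "\<exists>b\<in>W. w b i \<noteq> 0")
    case False
    obtain W0 where W0: "W0 \<subseteq> W" "finite W0" "card W0 \<le> card I"
      "\<And>x a. \<forall>a\<in>W0. (\<Sum>i\<in>I. w a i * x i) = 0 \<Longrightarrow> a \<in> W \<Longrightarrow> (\<Sum>i\<in>I. w a i * x i) = 0"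
      using insert.IH[of w] by blast
    show ?thesis
    proof (rule exI[of _ W0], intro conjI allI impI ballI)
      show "W0 \<subseteq> W" "finite W0" "card W0 \<le> card (insert i I)"
        using W0 insert.hyps by auto
      fix x a assume "\<forall>a\<in>W0. (\<Sum>i\<in>insert i I. w a i * x i) = 0" "a \<in> W"
      then show "(\<Sum>i\<in>insert i I. w a i * x i) = 0"
        using W0(1) W0(4)[of x a] False insert.hyps by (simp add: subset_iff)
    qed
  next
    case True
    then obtain b where b: "b \<in> W" "w b i \<noteq> 0" by blast
    define w' where "w' = (\<lambda>a j. w a j - w a i / w b i * w b j)"
    \<comment> \<open>On the hyperplane where the functional \<open>b\<close> vanishes, the reduced
      functionals agree with the original ones, so a separating set for \<open>w'\<close> becomes
      one for \<open>w\<close> once \<open>b\<close> is added.\<close>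
    have w': "(\<Sum>j\<in>I. w' a j * x j) = (\<Sum>j\<in>insert i I. w a j * x j)"
      if "(\<Sum>j\<in>insert i I. w b j * x j) = 0" for a x
    proof -
      have "(\<Sum>j\<in>I. w' a j * x j) = (\<Sum>j\<in>I. w a j * x j) - w a i / w b i * (\<Sum>j\<in>I. w b j * x j)"
        unfolding w'_def by (simp add: sum_subtractf sum_distrib_left algebra_simps)
      also have "(\<Sum>j\<in>I. w b j * x j) = - (w b i * x i)"
        using that insert.hyps by simp
      finally show ?thesis using b insert.hyps by simp
    qed
    obtain W0 where W0: "W0 \<subseteq> W" "finite W0" "card W0 \<le> card I"
      "\<And>x a. \<forall>a\<in>W0. (\<Sum>i\<in>I. w' a i * x i) = 0 \<Longrightarrow> a \<in> W \<Longrightarrow> (\<Sum>i\<in>I. w' a i * x i) = 0"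
      using insert.IH[of w'] by blast
    show ?thesis
    proof (rule exI[of _ "insert b W0"], intro conjI allI impI ballI)
      show "insert b W0 \<subseteq> W" "finite (insert b W0)" using W0 b by auto
      show "card (insert b W0) \<le> card (insert i I)"
        using W0(2,3) insert.hyps by (simp add: card_insert_if)
      fix x a assume h: "\<forall>a\<in>insert b W0. (\<Sum>i\<in>insert i I. w a i * x i) = 0" "a \<in> W"
      then have "\<forall>a\<in>W0. (\<Sum>i\<in>I. w' a i * x i) = 0" using w' by simp
      then show "(\<Sum>i\<in>insert i I. w a i * x i) = 0"
        using W0(4)[of x a] h w'[of x a] by simp
    qed
  qed
qed

text \<open>Turns "at most \<open>n\<close> elements" into a family indexed by exactly
  \<open>n\<close> numbers, with repetitions where needed.\<close>

lemma finite_surj_lessThan: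
  assumes "finite A" "A \<noteq> {}" "card A \<le> n"
  shows "\<exists>f. f ` {..<n} = A"
proof -
  obtain h where h: "bij_betw h {..<card A} A"
    using ex_bij_betw_nat_finite[OF assms(1)] by (auto simp: lessThan_atLeast0)
  have pos: "card A > 0" using assms by (simp add: card_gt_0_iff)
  define f where "f = (\<lambda>i. h (if i < card A then i else 0))"
  have img: "h ` {..<card A} = A" using h by (simp add: bij_betw_def)
  have "f ` {..<n} \<subseteq> h ` {..<card A}" using pos by (auto simp: f_def)
  moreover have "h ` {..<card A} \<subseteq> f ` {..<n}"
  proof
    fix y assume "y \<in> h ` {..<card A}"
    then obtain i where "i < card A" "y = h i" by blast
    then show "y \<in> f ` {..<n}" using assms(3) by (intro image_eqI[of _ _ i]) (auto simp: f_def)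
  qed
  ultimately have "f ` {..<n} = A" using img by simp
  then show ?thesis by (intro exI[of _ f])
qed

text \<open>Choosing \<open>d\<close> of the vectors with maximal \<open>|det|\<close>, Cramer's rule bounds all coordinates by 1.\<close>

lemma auerbach_basis:
  fixes M :: "(nat \<Rightarrow> real) set"
  assumes "finite M" and "\<And>y. \<forall>x\<in>M. (\<Sum>i<d. y i * x i) = 0 \<Longrightarrow> \<forall>i<d. y i = 0" and "d > 0"
  obtains v u where "\<And>j. j < d \<Longrightarrow> v j \<in> M" "dual_basis d v u"
    "\<And>x j. x \<in> M \<Longrightarrow> j < d \<Longrightarrow> \<bar>\<Sum>k<d. u j k * x k\<bar> \<le> 1"
proof -
  obtain M0 where M0: "M0 \<subseteq> M" "finite M0" "card M0 \<le> d"
    "\<And>y. \<forall>x\<in>M0. (\<Sum>i<d. x i * y i) = 0 \<Longrightarrow> \<forall>x\<in>M. (\<Sum>i<d. x i * y i) = 0"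
    using small_separating_subset[of "{..<d}" M "\<lambda>x. x"] by (auto simp only: finite_lessThan card_lessThan)
  have sep: "\<forall>i<d. y i = 0" if "\<forall>x\<in>M0. (\<Sum>i<d. y i * x i) = 0" for y
    using M0(4)[of y] that assms(2)[of y] by (simp add: mult.commute)
  have "M0 \<noteq> {}" using sep[of "\<lambda>_. 1"] assms(3) by auto
  then obtain f where f: "f ` {..<d} = M0" using finite_surj_lessThan[OF M0(2) _ M0(3)] by metis
  \<comment> \<open>A zero determinant would give a nonzero functional vanishing on all of
    \<open>M0\<close>, although \<open>M0\<close> separates functionals.\<close>
  have nz: "det (coord_mat d f) \<noteq> 0"
  proof
    assume "det (coord_mat d f) = 0"
    then obtain y where "\<exists>i<d. y i \<noteq> 0" "\<forall>j<d. (\<Sum>i<d. y i * f j i) = 0"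
      using det_coord_mat_eq_0 by blast
    then show False using sep[of y] f by auto
  qed
  let ?P = "PiE {..<d} (\<lambda>_. M)" and ?D = "\<lambda>v. \<bar>det (coord_mat d v)\<bar>"
  have fin: "finite ?P" using assms(1) by (simp add: finite_PiE)
  have upd: "v(j := x) \<in> ?P" if "v \<in> ?P" "x \<in> M" "j < d" for v j x
    using that by (auto simp: PiE_iff extensional_def)
  \<comment> \<open>Families must be extensional for the finite product \<open>?P\<close>; the
    matrix sees only indices below \<open>d\<close>, so restricting is harmless.\<close>
  have restr: "coord_mat d (restrict g {..<d}) = coord_mat d g" for g
    by (auto simp: coord_mat_def intro!: eq_matI)
  have fP: "restrict f {..<d} \<in> ?P" using f M0(1) by auto
  obtain v where v: "v \<in> ?P" "\<And>g. g \<in> ?P \<Longrightarrow> ?D g \<le> ?D v"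
  proof -
    have "?D ` ?P \<noteq> {}" using fP by blast
    then have "Max (?D ` ?P) \<in> ?D ` ?P" using fin by (intro Max_in finite_imageI)
    then obtain v where v: "v \<in> ?P" "?D v = Max (?D ` ?P)" by (metis (no_types, lifting) imageE)
    have "?D g \<le> ?D v" if "g \<in> ?P" for g
      unfolding v(2) using fin that by (intro Max_ge finite_imageI imageI)
    then show thesis using that v(1) by blast
  qed
  have pos: "?D v > 0" using v(2)[OF fP] nz unfolding restr[of f] by simp
  then obtain u where u: "dual_basis d v u" using dual_basis_exists[of d v] by fastforce
  have "\<bar>\<Sum>k<d. u j k * x k\<bar> \<le> 1" if "x \<in> M" "j < d" for x j
  proof -
    let ?t = "\<lambda>j. \<Sum>k<d. u j k * x k"
    have "det (coord_mat d (v(j := x))) = ?t j * det (coord_mat d v)"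
      by (rule cramer_coord_mat) (use that dual_basis_lincomb[OF u] in auto)
    moreover have "?D (v(j := x)) \<le> ?D v"
      by (rule v(2)[OF upd[OF v(1) that]])
    ultimately have "\<bar>?t j\<bar> * ?D v \<le> 1 * ?D v" by (simp add: abs_mult)
    then show ?thesis using pos mult_right_le_imp_le by blast
  qed
  then show thesis using that[of v u] v(1) u by blast
qed

section \<open>Recovering a lattice from finite data\<close>

lemma ip_lincomb:
  "ip d (lincomb d v t) (lincomb d v s) = (\<Sum>i<d. \<Sum>j<d. ip d (v i) (v j) * t i * s j)"
proof -
  have "ip d (lincomb d v t) (lincomb d v s) = (\<Sum>k<d. \<Sum>i<d. \<Sum>j<d. v i k * v j k * t i * s j)"
    unfolding ip_def lincomb_def sum_product by (simp add: mult_ac)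
  also have "\<dots> = (\<Sum>i<d. \<Sum>k<d. \<Sum>j<d. v i k * v j k * t i * s j)" by (rule sum.swap)
  also have "\<dots> = (\<Sum>i<d. \<Sum>j<d. \<Sum>k<d. v i k * v j k * t i * s j)"
    by (intro sum.cong sum.swap refl)
  finally show ?thesis unfolding ip_def by (simp add: sum_distrib_right)
qed

lemma lattice_iso_trans:
  assumes "lattice_iso d L1 L2" "lattice_iso d L2 L3"
  shows "lattice_iso d L1 L3"
proof -
  obtain U where U: "\<And>i j. i < d \<Longrightarrow> j < d \<Longrightarrow> (\<Sum>k<d. U k i * U k j) = (if i = j then 1 else 0)"
    "L2 = (\<lambda>x i. if i < d then (\<Sum>k<d. U i k * x k) else 0) ` L1"
    using assms(1) unfolding lattice_iso_def by blast
  obtain V where V: "\<And>i j. i < d \<Longrightarrow> j < d \<Longrightarrow> (\<Sum>k<d. V k i * V k j) = (if i = j then 1 else 0)"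
    "L3 = (\<lambda>x i. if i < d then (\<Sum>k<d. V i k * x k) else 0) ` L2"
    using assms(2) unfolding lattice_iso_def by blast
  define W where "W = (\<lambda>i j. \<Sum>a<d. U a j * V i a)"
  \<comment> \<open>\<open>W\<close> is the matrix product V U; its columns are combinations of the
    orthonormal columns of V with coefficients from U.\<close>
  have orth: "(\<Sum>k<d. W k i * W k j) = (if i = j then 1 else 0)" if "i < d" "j < d" for i j
  proof -
    have "(\<Sum>k<d. W k i * W k j)
        = ip d (lincomb d (\<lambda>a k. V k a) (\<lambda>a. U a i)) (lincomb d (\<lambda>a k. V k a) (\<lambda>a. U a j))"
      by (simp add: ip_def lincomb_def W_def)
    also have "\<dots> = (\<Sum>a<d. \<Sum>b<d. (if a = b then 1 else 0) * U a i * U b j)"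
      unfolding ip_lincomb by (intro sum.cong refl) (simp add: ip_def V(1))
    also have "\<dots> = (\<Sum>a<d. U a i * U a j)"
      by (intro sum.cong refl) (simp add: if_distrib[of "\<lambda>z. z * _"] cong: if_cong)
    finally show ?thesis using U(1) that by simp
  qed
  have "(\<Sum>k<d. V i k * (if k < d then \<Sum>l<d. U k l * x l else 0)) = (\<Sum>k<d. W i k * x k)" for i x
  proof -
    have "(\<Sum>k<d. V i k * (if k < d then \<Sum>l<d. U k l * x l else 0))
        = (\<Sum>k<d. \<Sum>l<d. V i k * U k l * x l)"
      by (simp add: sum_distrib_left mult_ac)
    also have "\<dots> = (\<Sum>l<d. \<Sum>k<d. V i k * U k l * x l)" by (rule sum.swap)
    finally show ?thesis unfolding W_def sum_distrib_right by (simp add: mult_ac)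
  qed
  then have "L3 = (\<lambda>x i. if i < d then (\<Sum>k<d. W i k * x k) else 0) ` L1"
    unfolding V(2) U(2) image_image by (intro image_cong refl) (simp cong: if_cong)
  then show ?thesis unfolding lattice_iso_def using orth by (intro exI[of _ W]) simp
qed

text \<open>The factor is rational because \<open>K\<close> has a nonzero element. Written in lowest
  terms p/q, its denominator divides all of \<open>K\<close> and its numerator all of
  \<open>K'\<close>, so both are 1.\<close>

lemma Gcd_one_scaling:
  fixes K K' :: "int set" and r :: real
  assumes "Gcd K = 1" "Gcd K' = 1" "r > 0"
    and K: "\<And>k. k \<in> K \<Longrightarrow> \<exists>k'\<in>K'. of_int k' = r * of_int k"
    and K': "\<And>k'. k' \<in> K' \<Longrightarrow> \<exists>k\<in>K. of_int k' = r * of_int k"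
  shows "r = 1"
proof -
  obtain k0 where k0: "k0 \<in> K" "k0 \<noteq> 0" using assms(1) Gcd_0_iff[of K] by auto
  obtain k0' where "of_int k0' = r * of_int k0" using K k0 by blast
  then have "r = of_int k0' / of_int k0" using k0 by simp
  then have "r \<in> \<rat>" by simp
  then obtain p q :: nat where pq: "q \<noteq> 0" "\<bar>r\<bar> = real p / real q" "coprime p q"
    by (rule Rats_abs_nat_div_natE)
  have eq: "int q * k' = int p * k" if "real_of_int k' = r * of_int k" for k k'
  proof -
    have "real_of_int (int q * k') = real_of_int (int p * k)"
      using that pq(1,2) assms(3) by (simp add: field_simps)
    then show ?thesis by linarith
  qed
  have "int q dvd k" if "k \<in> K" for k
  proof -
    obtain k' where "int q * k' = int p * k" using K[OF \<open>k \<in> K\<close>] eq by blast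
    then have "int q dvd int p * k" by (metis dvd_triv_left)
    then show ?thesis using pq(3) by (simp add: coprime_dvd_mult_right_iff coprime_commute)
  qed
  then have "int q dvd 1" using assms(1) Gcd_greatest[of K "int q"] by metis
  moreover have "int p dvd k'" if "k' \<in> K'" for k'
  proof -
    obtain k where "int q * k' = int p * k" using K'[OF \<open>k' \<in> K'\<close>] eq by blast
    then have "int p dvd int q * k'" by (metis dvd_triv_left)
    then show ?thesis using pq(3) by (simp add: coprime_dvd_mult_right_iff)
  qed
  then have "int p dvd 1" using assms(2) Gcd_greatest[of K' "int p"] by metis
  ultimately show ?thesis using pq(2) assms(3) by simp
qed

text \<open>The integer vectors are built in, so \<open>g\<close> matters only modulo 1 and its
  entries can be taken as fractions in [0,1).\<close>

definition coord_lattice :: "nat \<Rightarrow> (nat \<Rightarrow> nat \<Rightarrow> real) \<Rightarrow> (nat \<Rightarrow> real) set" where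
  "coord_lattice d g = {t. is_vec d t \<and>
     (\<exists>(c::nat \<Rightarrow> int) (e::nat \<Rightarrow> int). \<forall>i<d. t i = (\<Sum>j<d. of_int (c j) * g j i) + of_int (e i))}"

definition unit_box :: "nat \<Rightarrow> (nat \<Rightarrow> real) set" where
  "unit_box d = {t. is_vec d t \<and> (\<forall>i<d. \<bar>t i\<bar> \<le> 1)}"

text \<open>\<open>g\<close> generates, together with the integer vectors, the coordinates of \<open>L\<close> in the basis \<open>v\<close>;
  \<open>W\<close> lists coordinates of minimal vectors whose tensors determine every quadratic form.\<close>

definition realizes_by ::
  "nat \<Rightarrow> (nat \<Rightarrow> real) set \<Rightarrow> (nat \<Rightarrow> nat \<Rightarrow> real) \<Rightarrow> (nat \<Rightarrow> nat \<Rightarrow> real) \<Rightarrow>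
   (nat \<Rightarrow> nat \<Rightarrow> real) \<Rightarrow> real \<Rightarrow> bool" where
  "realizes_by d L g W v m \<longleftrightarrow> (\<exists>u. dual_basis d v u) \<and> (\<forall>j<d. is_vec d (v j)) \<and> m > 0 \<and>
     L = lincomb d v ` coord_lattice d g \<and>
     (\<forall>k<d*d. ip d (lincomb d v (W k)) (lincomb d v (W k)) = m) \<and>
     (\<forall>B. (\<forall>i<d. \<forall>j<d. B i j = B j i) \<longrightarrow>
        (\<forall>k<d*d. (\<Sum>i<d. \<Sum>j<d. B i j * W k i * W k j) = 0) \<longrightarrow> (\<forall>i<d. \<forall>j<d. B i j = 0))"

definition realizes ::
  "nat \<Rightarrow> (nat \<Rightarrow> real) set \<Rightarrow> (nat \<Rightarrow> nat \<Rightarrow> real) \<Rightarrow> (nat \<Rightarrow> nat \<Rightarrow> real) \<Rightarrow> bool" where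
  "realizes d L g W \<longleftrightarrow> (\<exists>v m. realizes_by d L g W v m)"

lemma realizes_byD:
  assumes "realizes_by d L g W v m"
  shows "\<exists>u. dual_basis d v u" "\<And>j. j < d \<Longrightarrow> is_vec d (v j)" "m > 0"
    "L = lincomb d v ` coord_lattice d g"
    "\<And>k. k < d * d \<Longrightarrow> ip d (lincomb d v (W k)) (lincomb d v (W k)) = m"
    "\<And>B. \<forall>i<d. \<forall>j<d. B i j = B j i \<Longrightarrow>
        \<forall>k<d*d. (\<Sum>i<d. \<Sum>j<d. B i j * W k i * W k j) = 0 \<Longrightarrow> \<forall>i<d. \<forall>j<d. B i j = 0"
  using assms unfolding realizes_by_def by simp_all

lemma lincomb_is_vec: "(\<And>j. j < d \<Longrightarrow> is_vec d (v j)) \<Longrightarrow> is_vec d (lincomb d v t)"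
  by (simp add: is_vec_def lincomb_def)

text \<open>Both lattices are the same coordinate set seen through two bases. The data in
  \<open>W\<close> make the two Gram matrices proportional, primitivity makes them equal, and equal
  Gram matrices give an isometry between the bases.\<close>

lemma realizes_iso:
  assumes "realizes d L g W" "realizes d L' g W" "prim_integral d L" "prim_integral d L'"
  shows "lattice_iso d L L'"
proof -
  obtain v m where R: "realizes_by d L g W v m" using assms(1) unfolding realizes_def by blast
  obtain v' m' where R': "realizes_by d L' g W v' m'" using assms(2) unfolding realizes_def by blast
  obtain u where u: "dual_basis d v u" using realizes_byD(1)[OF R] by blast
  note v = u realizes_byD(2-5)[OF R] and sep = realizes_byD(6)[OF R] and v' = realizes_byD(2-5)[OF R']
  have ip_sym: "ip d x y = ip d y x" for x y by (simp add: ip_def mult.commute)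
  \<comment> \<open>Weighting each Gram matrix by the other minimum makes the difference vanish on
    every \<open>W k\<close>.\<close>
  define B where "B = (\<lambda>i j. m * ip d (v' i) (v' j) - m' * ip d (v i) (v j))"
  have "\<forall>i<d. \<forall>j<d. B i j = 0"
  proof (rule sep)
    show "\<forall>i<d. \<forall>j<d. B i j = B j i" unfolding B_def using ip_sym by simp
    show "\<forall>k<d*d. (\<Sum>i<d. \<Sum>j<d. B i j * W k i * W k j) = 0"
    proof (intro allI impI)
      fix k assume k: "k < d * d"
      have "(\<Sum>i<d. \<Sum>j<d. B i j * W k i * W k j)
        = m * ip d (lincomb d v' (W k)) (lincomb d v' (W k)) - m' * ip d (lincomb d v (W k)) (lincomb d v (W k))"
        unfolding ip_lincomb B_def
        by (simp add: sum_distrib_left sum_subtractf[symmetric] algebra_simps)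
      then show "(\<Sum>i<d. \<Sum>j<d. B i j * W k i * W k j) = 0" using v(5)[OF k] v'(4)[OF k] by simp
    qed
  qed
  then have gram: "ip d (v' i) (v' j) = m' / m * ip d (v i) (v j)" if "i < d" "j < d" for i j
    using that v(3) by (simp add: B_def field_simps)
  have scal: "ip d (lincomb d v' t) (lincomb d v' s) = m' / m * ip d (lincomb d v t) (lincomb d v s)" for t s
    unfolding ip_lincomb sum_distrib_left by (intro sum.cong refl) (simp add: gram)
  have "m' / m = 1"
  proof (rule Gcd_one_scaling)
    show "Gcd {k::int. \<exists>x\<in>L. \<exists>y\<in>L. ip d x y = of_int k} = 1"
      "Gcd {k::int. \<exists>x\<in>L'. \<exists>y\<in>L'. ip d x y = of_int k} = 1"
      using assms(3,4) unfolding prim_integral_def by blast+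
    show "m' / m > 0" using v(3) v'(2) by simp
  next
    fix k assume "k \<in> {k::int. \<exists>x\<in>L. \<exists>y\<in>L. ip d x y = of_int k}"
    then obtain t s where ts: "t \<in> coord_lattice d g" "s \<in> coord_lattice d g"
      "ip d (lincomb d v t) (lincomb d v s) = of_int k" unfolding v(4) by auto
    have "ip d (lincomb d v' t) (lincomb d v' s) \<in> \<int>"
      using assms(4) ts(1,2) unfolding prim_integral_def v'(3) by blast
    then obtain k' where "ip d (lincomb d v' t) (lincomb d v' s) = of_int k'" by (auto elim: Ints_cases)
    then show "\<exists>k'\<in>{k::int. \<exists>x\<in>L'. \<exists>y\<in>L'. ip d x y = of_int k}. of_int k' = m' / m * of_int k"
      using ts scal[of t s] unfolding v'(3) by auto
  next
    fix k assume "k \<in> {k::int. \<exists>x\<in>L'. \<exists>y\<in>L'. ip d x y = of_int k}"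
    then obtain t s where ts: "t \<in> coord_lattice d g" "s \<in> coord_lattice d g"
      "ip d (lincomb d v' t) (lincomb d v' s) = of_int k" unfolding v'(3) by auto
    have "ip d (lincomb d v t) (lincomb d v s) \<in> \<int>"
      using assms(3) ts(1,2) unfolding prim_integral_def v(4) by blast
    then obtain k' where k': "ip d (lincomb d v t) (lincomb d v s) = of_int k'" by (auto elim: Ints_cases)
    have "of_int k = m' / m * of_int k'" using scal[of t s] ts(3) k' by simp
    with ts(1,2) k' show "\<exists>k'\<in>{k::int. \<exists>x\<in>L. \<exists>y\<in>L. ip d x y = of_int k}. of_int k = m' / m * of_int k'"
      unfolding v(4) using ts(1,2) k' by blast
  qed
  then have isom: "ip d (lincomb d v' t) (lincomb d v' s) = ip d (lincomb d v t) (lincomb d v s)" for t s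
    using scal by simp
  \<comment> \<open>The linear map sending each \<open>v l\<close> to \<open>v' l\<close>: column
    \<open>i\<close> is the image of the standard vector e_i, whose coordinates in the basis
    \<open>v\<close> are \<open>u l i\<close>.\<close>
  define U where "U = (\<lambda>k i. lincomb d v' (\<lambda>l. u l i) k)"
  have "(\<Sum>k<d. U k i * U k j) = (if i = j then 1 else 0)" if "i < d" "j < d" for i j
  proof -
    have "(\<Sum>k<d. U k i * U k j) = ip d (lincomb d v (\<lambda>l. u l i)) (lincomb d v (\<lambda>l. u l j))"
      unfolding isom[symmetric] by (simp add: U_def ip_def)
    also have "\<dots> = (\<Sum>k<d. (if i = k then 1 else 0) * (if j = k then 1 else 0))"
      unfolding ip_def lincomb_def
      by (intro sum.cong refl) (use v(1) that in \<open>auto simp: dual_basis_def\<close>)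
    also have "\<dots> = (if i = j then 1 else 0)" using that by (simp add: if_distrib[of "\<lambda>z. z * _"] cong: if_cong)
    finally show ?thesis .
  qed
  moreover have "lincomb d v' t = (\<lambda>i. if i < d then (\<Sum>k<d. U i k * lincomb d v t k) else 0)" for t
  proof (rule ext)
    fix i
    have "(\<Sum>k<d. U i k * lincomb d v t k) = (\<Sum>k<d. \<Sum>l<d. v' l i * (u l k * lincomb d v t k))"
      unfolding U_def lincomb_def[of d v'] by (simp add: sum_distrib_right sum_distrib_left mult_ac)
    also have "\<dots> = (\<Sum>l<d. v' l i * (\<Sum>k<d. u l k * lincomb d v t k))"
      by (subst sum.swap) (simp add: sum_distrib_left)
    also have "\<dots> = lincomb d v' t i"
      unfolding lincomb_def[of d v'] by (intro sum.cong refl) (simp add: dual_basis_coord[OF v(1)])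
    finally show "lincomb d v' t i = (if i < d then (\<Sum>k<d. U i k * lincomb d v t k) else 0)"
      using lincomb_is_vec[of d v' t, OF v'(1)] by (auto simp: is_vec_def)
  qed
  then have "L' = (\<lambda>x i. if i < d then (\<Sum>k<d. U i k * x k) else 0) ` L"
    unfolding v'(3) v(4) image_image by (intro image_cong refl)
  ultimately show ?thesis unfolding lattice_iso_def by (intro exI[of _ U]) simp
qed

lemma lattice_of_diff:
  assumes "x \<in> lattice_of d b" "y \<in> lattice_of d b"
  shows "(\<lambda>i. x i - y i) \<in> lattice_of d b"
proof -
  obtain c e :: "nat \<Rightarrow> int" where
    "x = (\<lambda>i. \<Sum>j<d. of_int (c j) * b j i)" "y = (\<lambda>i. \<Sum>j<d. of_int (e j) * b j i)"
    using assms unfolding lattice_of_def by blast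
  then show ?thesis unfolding lattice_of_def
    by (intro CollectI exI[of _ "\<lambda>j. c j - e j"]) (simp add: left_diff_distrib sum_subtractf)
qed

lemma lattice_of_add_scale:
  assumes "x \<in> lattice_of d b" "y \<in> lattice_of d b"
  shows "(\<lambda>i. x i + of_int k * y i) \<in> lattice_of d b"
proof -
  obtain c e :: "nat \<Rightarrow> int" where
    "x = (\<lambda>i. \<Sum>j<d. of_int (c j) * b j i)" "y = (\<lambda>i. \<Sum>j<d. of_int (e j) * b j i)"
    using assms unfolding lattice_of_def by blast
  then have "(\<lambda>i. x i + of_int k * y i) = (\<lambda>i. \<Sum>j<d. of_int (c j + k * e j) * b j i)"
    by (simp add: distrib_right sum.distrib sum_distrib_left mult.assoc)
  then show ?thesis unfolding lattice_of_def by (intro CollectI exI[of _ "\<lambda>j. c j + k * e j"])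
qed

lemma lattice_of_int_comb:
  fixes n :: nat
  assumes "\<And>j. j < n \<Longrightarrow> x j \<in> lattice_of d b"
  shows "(\<lambda>i. \<Sum>j<n. of_int (c j) * x j i) \<in> lattice_of d b"
  using assms
proof (induction n)
  case 0
  show ?case unfolding lattice_of_def by (intro CollectI exI[of _ "\<lambda>_. 0"]) simp
next
  case (Suc n)
  then show ?case using lattice_of_add_scale[of "\<lambda>i. \<Sum>j<n. of_int (c j) * x j i" d b "x n" "c n"] by simp
qed

section \<open>Perfection as a separation property, and the packing bound\<close>

text \<open>Expanding one factor of the Frobenius norm of \<open>B\<close> in the spanning tensors
  turns it into a combination of the values of \<open>B\<close> at minimal vectors, all
  zero.\<close>

lemma perfect_separates:
  assumes "perfect d L" "\<forall>i<d. \<forall>j<d. B i j = B j i"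
    and "\<And>x. x \<in> min_vecs d L \<Longrightarrow> (\<Sum>i<d. \<Sum>j<d. B i j * x i * x j) = 0"
  shows "\<forall>i<d. \<forall>j<d. B i j = 0"
proof -
  let ?M = "min_vecs d L"
  obtain a where "\<forall>i<d. \<forall>j<d. B i j = (\<Sum>v\<in>?M. a v * v i * v j)"
    using assms(1)[unfolded perfect_def, THEN spec, of B, THEN mp, OF assms(2)] ..
  then have a: "B i j = (\<Sum>v\<in>?M. a v * v i * v j)" if "i < d" "j < d" for i j
    using that by simp
  have "(\<Sum>i<d. \<Sum>j<d. B i j * B i j) = (\<Sum>i<d. \<Sum>j<d. \<Sum>v\<in>?M. B i j * (a v * v i * v j))"
    by (intro sum.cong refl) (simp add: a sum_distrib_left)
  also have "\<dots> = (\<Sum>i<d. \<Sum>v\<in>?M. \<Sum>j<d. B i j * (a v * v i * v j))"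
    by (intro sum.cong refl sum.swap)
  also have "\<dots> = (\<Sum>v\<in>?M. \<Sum>i<d. \<Sum>j<d. B i j * (a v * v i * v j))" by (rule sum.swap)
  also have "\<dots> = (\<Sum>v\<in>?M. a v * (\<Sum>i<d. \<Sum>j<d. B i j * v i * v j))"
    by (simp add: sum_distrib_left mult_ac)
  also have "\<dots> = 0" by (simp add: assms(3))
  finally have "(\<Sum>i<d. \<Sum>j<d. B i j * B i j) = 0" .
  then have rows: "\<forall>i\<in>{..<d}. (\<Sum>j<d. B i j * B i j) = 0"
    by (subst (asm) sum_nonneg_eq_0_iff) (auto intro: sum_nonneg)
  have entries: "\<forall>j\<in>{..<d}. B i j * B i j = 0" if "(\<Sum>j<d. B i j * B i j) = 0" for i
    using that by (subst (asm) sum_nonneg_eq_0_iff) auto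
  show ?thesis
  proof (intro allI impI)
    fix i j assume "i < d" "j < d"
    then have "B i j * B i j = 0" using entries[OF rows[THEN bspec, of i]] by blast
    then show "B i j = 0" by simp
  qed
qed

text \<open>A functional \<open>y\<close> vanishing on the minimal vectors makes the rank one form
  \<open>y i * y j\<close> vanish there too.\<close>

lemma perfect_min_vecs_span:
  assumes "perfect d L" "\<forall>x\<in>min_vecs d L. (\<Sum>i<d. y i * x i) = 0"
  shows "\<forall>i<d. y i = 0"
proof -
  have "\<forall>i<d. \<forall>j<d. y i * y j = 0"
  proof (rule perfect_separates[OF assms(1)])
    fix x assume "x \<in> min_vecs d L"
    then have "(\<Sum>i<d. y i * x i) * (\<Sum>j<d. y j * x j) = 0" using assms(2) by simp
    then show "(\<Sum>i<d. \<Sum>j<d. y i * y j * x i * x j) = 0" unfolding sum_product by (simp add: mult_ac)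
  qed (simp add: mult.commute)
  then have "y i * y i = 0" if "i < d" for i using that by blast
  then show ?thesis by simp
qed

text \<open>A sum over an infinite or empty set is 0 in HOL, so the all-ones matrix could not be
  represented in either case.\<close>

lemma perfect_min_vecs_finite:
  assumes "perfect d L" "d > 0"
  shows "finite (min_vecs d L)" "min_vecs d L \<noteq> {}"
proof -
  obtain a where "\<forall>i<d. \<forall>j<d. (1::real) = (\<Sum>v\<in>min_vecs d L. a v * v i * v j)"
    using assms(1)[unfolded perfect_def, rule_format, of "\<lambda>_ _. 1"] by auto
  then have "(\<Sum>v\<in>min_vecs d L. a v * v 0 * v 0) \<noteq> 0" using assms(2) by force
  then show "finite (min_vecs d L)" "min_vecs d L \<noteq> {}" by (auto intro: ccontr)
qed

text \<open>Moves a form from coordinate space to the ambient space; evaluation at minimal vectors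
  and at basis vectors both use it.\<close>

lemma bilinear_pullback:
  fixes B :: "nat \<Rightarrow> nat \<Rightarrow> real"
  shows "(\<Sum>a<d. \<Sum>b<d. (\<Sum>i<d. \<Sum>j<d. B i j * u i a * u j b) * x a * y b)
    = (\<Sum>i<d. \<Sum>j<d. B i j * (\<Sum>a<d. u i a * x a) * (\<Sum>b<d. u j b * y b))"
proof -
  have "(\<Sum>a<d. \<Sum>b<d. (\<Sum>i<d. \<Sum>j<d. B i j * u i a * u j b) * x a * y b)
      = (\<Sum>a<d. \<Sum>b<d. \<Sum>i<d. \<Sum>j<d. B i j * u i a * u j b * x a * y b)"
    by (simp add: sum_distrib_right)
  also have "\<dots> = (\<Sum>a<d. \<Sum>i<d. \<Sum>b<d. \<Sum>j<d. B i j * u i a * u j b * x a * y b)"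
    by (intro sum.cong refl sum.swap)
  also have "\<dots> = (\<Sum>i<d. \<Sum>a<d. \<Sum>b<d. \<Sum>j<d. B i j * u i a * u j b * x a * y b)"
    by (rule sum.swap)
  also have "\<dots> = (\<Sum>i<d. \<Sum>a<d. \<Sum>j<d. \<Sum>b<d. B i j * u i a * u j b * x a * y b)"
    by (intro sum.cong refl sum.swap)
  also have "\<dots> = (\<Sum>i<d. \<Sum>j<d. \<Sum>a<d. \<Sum>b<d. B i j * u i a * u j b * x a * y b)"
    by (intro sum.cong refl sum.swap)
  also have "\<dots> = (\<Sum>i<d. \<Sum>j<d. B i j * ((\<Sum>a<d. u i a * x a) * (\<Sum>b<d. u j b * y b)))"
    unfolding sum_product unfolding sum_distrib_left by (simp add: mult_ac)
  finally show ?thesis by (simp add: mult.assoc)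
qed

text \<open>The squared triangle inequality for vectors of common norm; the Gram entries are bounded
  by \<open>m\<close> through 2|xy| <= x^2 + y^2 in each coordinate.\<close>

lemma ip_lincomb_le:
  assumes "\<And>j. j < d \<Longrightarrow> ip d (v j) (v j) = m"
  shows "ip d (lincomb d v t) (lincomb d v t) \<le> (\<Sum>i<d. \<bar>t i\<bar>)\<^sup>2 * m"
proof -
  have "\<bar>ip d (v i) (v j)\<bar> \<le> m" if "i < d" "j < d" for i j
  proof -
    have "2 * \<bar>ip d (v i) (v j)\<bar> \<le> (\<Sum>k<d. 2 * \<bar>v i k * v j k\<bar>)"
      unfolding ip_def sum_distrib_left[symmetric] by (simp add: sum_abs)
    also have "\<dots> \<le> (\<Sum>k<d. v i k * v i k + v j k * v j k)"
    proof (intro sum_mono)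
      fix k
      show "2 * \<bar>v i k * v j k\<bar> \<le> v i k * v i k + v j k * v j k"
        using sum_squares_bound[of "\<bar>v i k\<bar>" "\<bar>v j k\<bar>"] by (simp add: abs_mult power2_eq_square)
    qed
    also have "\<dots> = 2 * m" using assms that by (simp add: sum.distrib ip_def)
    finally show ?thesis by simp
  qed
  then have "ip d (v i) (v j) * t i * t j \<le> \<bar>t i\<bar> * \<bar>t j\<bar> * m" if "i < d" "j < d" for i j
  proof -
    have "ip d (v i) (v j) * t i * t j \<le> \<bar>ip d (v i) (v j)\<bar> * (\<bar>t i\<bar> * \<bar>t j\<bar>)"
      by (metis abs_ge_self abs_mult mult.assoc)
    also have "\<dots> \<le> m * (\<bar>t i\<bar> * \<bar>t j\<bar>)" using \<open>\<And>i j. i < d \<Longrightarrow> j < d \<Longrightarrow> _\<close> that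
      by (intro mult_right_mono) auto
    finally show ?thesis by (simp add: mult_ac)
  qed
  then have "ip d (lincomb d v t) (lincomb d v t) \<le> (\<Sum>i<d. \<Sum>j<d. \<bar>t i\<bar> * \<bar>t j\<bar> * m)"
    unfolding ip_lincomb by (intro sum_mono) auto
  also have "\<dots> = (\<Sum>i<d. \<bar>t i\<bar>)\<^sup>2 * m"
    unfolding power2_eq_square sum_product unfolding sum_distrib_right ..
  finally show ?thesis .
qed

text \<open>Packing: two lattice points in the same cell of side \<open>1/(d+1)\<close> would differ by a vector that is
  shorter than the minimum.\<close>

lemma unit_box_points_bound:
  fixes T :: "(nat \<Rightarrow> real) set"
  assumes m: "m > 0" "\<And>j. j < d \<Longrightarrow> ip d (v j) (v j) = m"
    and sep: "\<And>t s. t \<in> T \<Longrightarrow> s \<in> T \<Longrightarrow> t \<noteq> s \<Longrightarrow>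
      m \<le> ip d (lincomb d v (\<lambda>i. t i - s i)) (lincomb d v (\<lambda>i. t i - s i))"
  shows "finite (T \<inter> unit_box d) \<and> card (T \<inter> unit_box d) \<le> (2 * d + 3) ^ d"
proof -
  \<comment> \<open>Coordinates in [-1,1] are scaled by \<open>d+1\<close>, so the floors run from
    \<open>-(d+1)\<close> to \<open>d+1\<close>, both included: \<open>2*d+3\<close> values
    each.\<close>
  let ?h = "\<lambda>t::nat \<Rightarrow> real. restrict (\<lambda>i. \<lfloor>t i * real (d + 1)\<rfloor>) {..<d}"
  let ?R = "PiE {..<d} (\<lambda>_. {- int (d + 1)..int (d + 1)})"
  have sub: "?h ` (T \<inter> unit_box d) \<subseteq> ?R"
  proof (rule image_subsetI, rule restrict_PiE_iff[THEN iffD2], rule ballI)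
    fix t i assume t: "t \<in> T \<inter> unit_box d" "i \<in> {..<d}"
    then have "\<bar>t i\<bar> \<le> 1" by (auto simp: unit_box_def)
    then have "\<bar>t i * real (d + 1)\<bar> \<le> real (d + 1)" by (simp add: abs_mult mult_left_le_one_le)
    then have "- real (d + 1) \<le> t i * real (d + 1)" "t i * real (d + 1) \<le> real (d + 1)" by linarith+
    then show "\<lfloor>t i * real (d + 1)\<rfloor> \<in> {- int (d + 1)..int (d + 1)}"
      by (simp only: atLeastAtMost_iff) linarith
  qed
  have inj: "inj_on ?h (T \<inter> unit_box d)"
  proof (rule inj_onI, rule ccontr)
    fix t s assume ts: "t \<in> T \<inter> unit_box d" "s \<in> T \<inter> unit_box d" "?h t = ?h s" "t \<noteq> s"
    let ?z = "\<lambda>i. t i - s i"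
    have close: "\<bar>?z i\<bar> \<le> 1 / real (d + 1)" if "i < d" for i
    proof -
      have "\<lfloor>t i * real (d + 1)\<rfloor> = \<lfloor>s i * real (d + 1)\<rfloor>" using fun_cong[OF ts(3), of i] that by simp
      then have "\<bar>t i * real (d + 1) - s i * real (d + 1)\<bar> \<le> 1" by linarith
      then have "\<bar>?z i\<bar> * real (d + 1) \<le> 1"
        by (metis abs_mult abs_of_nat left_diff_distrib)
      then show ?thesis by (simp add: pos_le_divide_eq)
    qed
    \<comment> \<open>The cell side 1/(d+1) makes the sum of \<open>d\<close> terms d/(d+1),
      strictly below 1.\<close>
    have "(\<Sum>i<d. \<bar>?z i\<bar>) \<le> (\<Sum>i<d. 1 / real (d + 1))" by (intro sum_mono close) simp
    also have "\<dots> < 1" by simp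
    finally have "(\<Sum>i<d. \<bar>?z i\<bar>) < 1" .
    then have "(\<Sum>i<d. \<bar>?z i\<bar>)\<^sup>2 < 1"
      by (simp add: abs_square_less_1 sum_nonneg)
    then have "(\<Sum>i<d. \<bar>?z i\<bar>)\<^sup>2 * m < 1 * m" using m(1) by (intro mult_strict_right_mono)
    then have "ip d (lincomb d v ?z) (lincomb d v ?z) < m"
      using ip_lincomb_le[of d v m ?z, OF m(2)] by linarith
    then show False using sep[of t s] ts by auto
  qed
  have "finite (T \<inter> unit_box d)" by (rule inj_on_finite[OF inj sub]) (simp add: finite_PiE)
  moreover have "card (T \<inter> unit_box d) \<le> card ?R" by (rule card_inj_on_le[OF inj sub]) (simp add: finite_PiE)
  moreover have "card ?R = (2 * d + 3) ^ d" by (simp add: card_PiE nat_add_distrib nat_mult_distrib add.commute)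
  ultimately show ?thesis by simp
qed

section \<open>Counting perfect lattices from above\<close>

text \<open>Contains all fractions in [0,1) with denominator at most \<open>K\<close>. Listing
  numerators up to \<open>K\<close> independently of the denominator also admits larger values but
  keeps the simple count \<open>K * K\<close>.\<close>

definition fractions_upto :: "nat \<Rightarrow> real set" where
  "fractions_upto K = (\<lambda>(a, q). real a / real q) ` ({..<K} \<times> {1..K})"

lemma card_fractions_upto: "finite (fractions_upto K) \<and> card (fractions_upto K) \<le> K * K"
proof -
  have "card (fractions_upto K) \<le> card ({..<K} \<times> {1..K})"
    unfolding fractions_upto_def by (intro card_image_le) simp
  then show ?thesis unfolding fractions_upto_def by simp
qed

lemma frac_in_fractions_upto:
  assumes "1 \<le> q" "q \<le> K" "\<beta> * real q \<in> \<int>"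
  shows "frac \<beta> \<in> fractions_upto K"
proof -
  have "frac \<beta> * real q = \<beta> * real q - of_int \<lfloor>\<beta>\<rfloor> * real q" by (simp add: frac_def left_diff_distrib)
  also have "\<dots> \<in> \<int>" using assms(3) by (intro Ints_diff) auto
  finally obtain z where z: "frac \<beta> * real q = of_int z" by (auto elim: Ints_cases)
  have "0 \<le> frac \<beta> * real q" "frac \<beta> * real q < real q"
    using frac_ge_0[of \<beta>] frac_lt_1[of \<beta>] assms(1) by auto
  then have "0 \<le> z" "z < int q" unfolding z by linarith+
  then have "frac \<beta> = real (nat z) / real q" "nat z < K" using z assms by (auto simp: field_simps)
  then show ?thesis using assms unfolding fractions_upto_def by force
qed

lemma perfect_basis:
  assumes "is_lattice d L" "perfect d L" "d > 0"
  obtains v u m where "dual_basis d v u" "\<And>j. j < d \<Longrightarrow> v j \<in> min_vecs d L" "m > 0"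
    "\<And>x. x \<in> min_vecs d L \<Longrightarrow> ip d x x = m"
    "\<And>x. x \<in> L \<Longrightarrow> x \<noteq> (\<lambda>i. 0) \<Longrightarrow> m \<le> ip d x x"
    "\<And>x j. x \<in> min_vecs d L \<Longrightarrow> j < d \<Longrightarrow> \<bar>\<Sum>k<d. u j k * x k\<bar> \<le> 1"
    "\<And>x. x \<in> L \<Longrightarrow> is_vec d x"
proof -
  note fin = perfect_min_vecs_finite[OF assms(2,3)]
  have vec: "is_vec d x" if "x \<in> L" for x
  proof -
    obtain b where "\<forall>j<d. is_vec d (b j)" "L = lattice_of d b"
      using assms(1) unfolding is_lattice_def by blast
    then show ?thesis using that unfolding lattice_of_def is_vec_def by auto
  qed
  obtain x0 where x0: "x0 \<in> min_vecs d L" using fin(2) by blast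
  define m where "m = ip d x0 x0"
  have le: "m \<le> ip d x x" if "x \<in> L" "x \<noteq> (\<lambda>i. 0)" for x
    using x0 that unfolding min_vecs_def m_def by blast
  have eq: "ip d x x = m" if "x \<in> min_vecs d L" for x
  proof (rule antisym)
    show "ip d x x \<le> m" using that x0 unfolding min_vecs_def m_def by blast
    show "m \<le> ip d x x" using that le unfolding min_vecs_def by blast
  qed
  have "m > 0"
  proof -
    have "x0 \<noteq> (\<lambda>i. 0)" "is_vec d x0" using x0 vec unfolding min_vecs_def by blast+
    then obtain i where "i < d" "x0 i \<noteq> 0" unfolding is_vec_def by (metis ext not_le)
    then have "0 < (\<Sum>i<d. x0 i * x0 i)" by (intro sum_pos2[of _ i]) (auto simp: zero_less_mult_iff)
    then show ?thesis by (simp add: m_def ip_def)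
  qed
  obtain v u where "\<And>j. j < d \<Longrightarrow> v j \<in> min_vecs d L" "dual_basis d v u"
    "\<And>x j. x \<in> min_vecs d L \<Longrightarrow> j < d \<Longrightarrow> \<bar>\<Sum>k<d. u j k * x k\<bar> \<le> 1"
    using auerbach_basis[OF fin(1) perfect_min_vecs_span[OF assms(2)] assms(3)] by blast
  then show thesis using that[of v u m] le eq \<open>m > 0\<close> vec by blast
qed

text \<open>Pigeonhole: among the multiples \<open>0, t, 2t, \<dots>, Kt\<close> two agree modulo integer vectors.\<close>

lemma bounded_denominator:
  assumes "finite (T \<inter> unit_box d)" "card (T \<inter> unit_box d) \<le> K"
    and "\<And>k e. is_vec d e \<Longrightarrow> (\<forall>i. e i \<in> \<int>) \<Longrightarrow> (\<lambda>i. real k * t i - e i) \<in> T"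
    and "is_vec d t"
  shows "\<exists>q\<in>{1..K}. \<forall>i<d. t i * real q \<in> \<int>"
proof -
  \<comment> \<open>The multiple \<open>k * t\<close> reduced coordinatewise into [0,1), which stays
    in \<open>T\<close> and lies in the unit box.\<close>
  define p where "p = (\<lambda>k::nat. \<lambda>i. real k * t i - of_int \<lfloor>real k * t i\<rfloor>)"
  have "p k \<in> T \<inter> unit_box d" for k
  proof
    show "p k \<in> T" unfolding p_def using assms(4) by (intro assms(3)) (auto simp: is_vec_def)
    have "\<bar>p k i\<bar> \<le> 1" for i unfolding p_def by linarith
    then show "p k \<in> unit_box d" using assms(4) by (auto simp: unit_box_def p_def is_vec_def)
  qed
  then have "p ` {0..K} \<subseteq> T \<inter> unit_box d" by blast
  then have "card (p ` {0..K}) \<le> card (T \<inter> unit_box d)" by (rule card_mono[OF assms(1)])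
  then have "card (p ` {0..K}) \<le> K" using assms(2) by (rule le_trans)
  \<comment> \<open>There are \<open>K + 1\<close> multiples, counting \<open>k = 0\<close>, for at
    most \<open>K\<close> points.\<close>
  then have "card (p ` {0..K}) < card {0..K}" unfolding card_atLeastAtMost by linarith
  then have ninj: "\<not> inj_on p {0..K}" by (rule pigeonhole)
  obtain k' l' where kl': "k' \<le> K" "l' \<le> K" "k' \<noteq> l'" "p k' = p l'"
  proof (rule ccontr)
    assume no: "\<not> thesis"
    have "inj_on p {0..K}"
    proof (rule inj_onI, rule ccontr)
      fix x y assume "x \<in> {0..K}" "y \<in> {0..K}" "p x = p y" "x \<noteq> y"
      then have thesis by (intro that[of x y]) simp_all
      with no show False ..
    qed
    with ninj show False ..
  qed
  define k l where "k = min k' l'" and "l = max k' l'"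
  have kl: "k \<le> K" "l \<le> K" "k < l" "p k = p l"
    using kl'(1-3) kl'(4) kl'(4)[symmetric] unfolding k_def l_def min_def max_def
    by (simp_all split: if_splits)
  have "t i * real (l - k) \<in> \<int>" for i
  proof -
    have "t i * real (l - k) = of_int (\<lfloor>real l * t i\<rfloor> - \<lfloor>real k * t i\<rfloor>)"
      using fun_cong[OF kl(4), of i] kl(3) unfolding p_def by (simp add: of_nat_diff algebra_simps)
    then show ?thesis by (metis Ints_of_int)
  qed
  then show ?thesis using kl by (intro bexI[of _ "l - k"]) auto
qed

text \<open>In the coordinates of an Auerbach basis of minimal vectors, \<open>L\<close> becomes a
  group \<open>T\<close> containing Z^d with at most \<open>K\<close> points in the unit box, so
  lattice coordinates have denominators at most \<open>K\<close>. Minimal vectors have coordinates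
  in that box, whence the finite range for \<open>W\<close>.\<close>

lemma realizes_exists:
  assumes "is_lattice d L" "perfect d L" "d > 0"
  defines "K \<equiv> (2 * d + 3) ^ d"
  shows "\<exists>g W. g \<in> ({..<d} \<rightarrow>\<^sub>E {..<d} \<rightarrow>\<^sub>E fractions_upto K) \<and>
    finite (coord_lattice d g \<inter> unit_box d) \<and> card (coord_lattice d g \<inter> unit_box d) \<le> K \<and>
    W \<in> ({..<d*d} \<rightarrow>\<^sub>E coord_lattice d g \<inter> unit_box d) \<and> realizes d L g W"
proof -
  obtain v u m where u: "dual_basis d v u" and vM: "\<And>j. j < d \<Longrightarrow> v j \<in> min_vecs d L" and m: "m > 0"
    "\<And>x. x \<in> min_vecs d L \<Longrightarrow> ip d x x = m"
    "\<And>x. x \<in> L \<Longrightarrow> x \<noteq> (\<lambda>i. 0) \<Longrightarrow> m \<le> ip d x x"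
    and small: "\<And>x j. x \<in> min_vecs d L \<Longrightarrow> j < d \<Longrightarrow> \<bar>\<Sum>k<d. u j k * x k\<bar> \<le> 1"
    and vec: "\<And>x. x \<in> L \<Longrightarrow> is_vec d x"
    by (rule perfect_basis[OF assms(1-3)], erule that, blast, assumption) simp_all
  obtain b where b: "L = lattice_of d b" using assms(1) unfolding is_lattice_def by blast
  have vL: "v j \<in> L" if "j < d" for j using vM[OF that] unfolding min_vecs_def by blast
  have bL: "b j \<in> L" if "j < d" for j
  proof -
    have "b j = (\<lambda>i. \<Sum>l<d. of_int (if l = j then 1 else 0) * b l i)"
      using that by (intro ext) (simp add: if_distrib[of of_int] if_distrib[of "\<lambda>z. z * _"] cong: if_cong)
    then show ?thesis unfolding b lattice_of_def
      by (intro CollectI exI[of _ "\<lambda>l. if l = j then 1 else 0"])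
  qed
  define \<beta> where "\<beta> = (\<lambda>x i. if i < d then \<Sum>k<d. u i k * x k else 0 :: real)"
  \<comment> \<open>\<open>L\<close> written in the coordinates of the basis
    \<open>v\<close>.\<close>
  define T where "T = {t. is_vec d t \<and> lincomb d v t \<in> L}"
  have \<beta>: "lincomb d v (\<beta> x) = x" if "is_vec d x" for x
  proof
    fix i
    have "lincomb d v (\<beta> x) i = lincomb d v (\<lambda>j. \<Sum>k<d. u j k * x k) i"
      unfolding lincomb_def \<beta>_def by (intro sum.cong) auto
    moreover have "is_vec d (lincomb d v (\<beta> x))"
      using vL vec by (intro lincomb_is_vec) blast
    ultimately show "lincomb d v (\<beta> x) i = x i"
      using dual_basis_lincomb[OF u, of i x] that by (cases "i < d") (auto simp: is_vec_def)
  qed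
  have coord: "t i = (\<Sum>k<d. u i k * lincomb d v t k)" if "i < d" for t i
    using dual_basis_coord[OF u that] by simp
  have \<beta>_vec: "is_vec d (\<beta> x)" for x by (simp add: is_vec_def \<beta>_def)
  have \<beta>T: "\<beta> x \<in> T" if "x \<in> L" for x using that \<beta>[OF vec[OF that]] \<beta>_vec by (simp add: T_def)
  have few: "finite (T \<inter> unit_box d) \<and> card (T \<inter> unit_box d) \<le> K"
    unfolding K_def
  proof (rule unit_box_points_bound[OF m(1)])
    show "ip d (v j) (v j) = m" if "j < d" for j using m(2) vM that by blast
    fix t s assume ts: "t \<in> T" "s \<in> T" "t \<noteq> s"
    show "m \<le> ip d (lincomb d v (\<lambda>i. t i - s i)) (lincomb d v (\<lambda>i. t i - s i))"
    proof (rule m(3))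
      have "lincomb d v (\<lambda>i. t i - s i) = (\<lambda>i. lincomb d v t i - lincomb d v s i)"
        by (simp add: lincomb_def left_diff_distrib sum_subtractf)
      then show "lincomb d v (\<lambda>i. t i - s i) \<in> L" using ts lattice_of_diff unfolding T_def b by simp
      show "lincomb d v (\<lambda>i. t i - s i) \<noteq> (\<lambda>i. 0)"
      proof
        assume 0: "lincomb d v (\<lambda>i. t i - s i) = (\<lambda>i. 0)"
        have "t i = s i" for i
          using coord[of i "\<lambda>i. t i - s i"] ts unfolding 0 by (cases "i < d") (auto simp: T_def is_vec_def)
        then show False using ts(3) by blast
      qed
    qed
  qed
  have T_int: "(\<lambda>i. real k * t i - e i) \<in> T"
    if "t \<in> T" "is_vec d e" "\<forall>i. e i \<in> \<int>" for t e k
  proof -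
    have "\<forall>i. \<exists>z. e i = of_int z" using that(3) by (auto elim: Ints_cases)
    then obtain z where z: "\<And>i. e i = of_int (z i)" by metis
    have "(\<lambda>i. \<Sum>j<d. of_int (- z j) * v j i) \<in> L" unfolding b
      by (rule lattice_of_int_comb) (use vL b in auto)
    then have "(\<lambda>i. (\<Sum>j<d. of_int (- z j) * v j i) + of_int (int k) * lincomb d v t i) \<in> L"
      using that(1) lattice_of_add_scale unfolding T_def b by blast
    moreover have "(\<Sum>j<d. of_int (- z j) * v j i) + of_int (int k) * lincomb d v t i
        = lincomb d v (\<lambda>i. real k * t i - e i) i" for i
      unfolding lincomb_def z by (simp add: sum_distrib_left sum_subtractf sum_negf left_diff_distrib mult.assoc)
    ultimately show ?thesis using that unfolding T_def by (simp add: is_vec_def)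
  qed
  \<comment> \<open>The coordinates of the original lattice basis \<open>b\<close>, reduced modulo
    1.\<close>
  define g where "g = restrict (\<lambda>j. restrict (\<lambda>i. frac (\<beta> (b j) i)) {..<d}) {..<d}"
  have g_eq: "g j i = \<beta> (b j) i - of_int \<lfloor>\<beta> (b j) i\<rfloor>" if "j < d" "i < d" for i j
    using that by (simp add: g_def frac_def)
  have g_in: "g \<in> {..<d} \<rightarrow>\<^sub>E {..<d} \<rightarrow>\<^sub>E fractions_upto K"
  proof -
    have "frac (\<beta> (b j) i) \<in> fractions_upto K" if "j < d" "i < d" for j i
    proof -
      have "\<exists>q\<in>{1..K}. \<forall>i<d. \<beta> (b j) i * real q \<in> \<int>"
        by (rule bounded_denominator[where T = T])
           (use few T_int \<beta>T[OF bL[OF that(1)]] \<beta>_vec in auto)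
      then show ?thesis using frac_in_fractions_upto that(2) by auto
    qed
    then show ?thesis unfolding g_def by simp
  qed
  have T_eq: "coord_lattice d g = T"
  proof (intro equalityI subsetI)
    fix t assume "t \<in> coord_lattice d g"
    then obtain c e :: "nat \<Rightarrow> int" where t: "is_vec d t"
      "\<And>i. i < d \<Longrightarrow> t i = (\<Sum>j<d. of_int (c j) * g j i) + of_int (e i)"
      unfolding coord_lattice_def by blast
    \<comment> \<open>The floors discarded in \<open>g\<close> are moved into the integer
      part.\<close>
    define z where "z = (\<lambda>i. e i - (\<Sum>j<d. c j * \<lfloor>\<beta> (b j) i\<rfloor>))"
    have ti: "t i = (\<Sum>j<d. of_int (c j) * \<beta> (b j) i) + of_int (z i)" if "i < d" for i
      using that unfolding t(2)[OF that] z_def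
      by (simp add: g_eq right_diff_distrib sum_subtractf)
    have "lincomb d v t k = (\<Sum>j<d. of_int (c j) * b j k) + (\<Sum>i<d. of_int (z i) * v i k)" for k
    proof -
      have "lincomb d v t k = (\<Sum>i<d. \<Sum>j<d. of_int (c j) * (\<beta> (b j) i * v i k)) + (\<Sum>i<d. of_int (z i) * v i k)"
        unfolding lincomb_def by (simp add: ti distrib_right sum.distrib sum_distrib_right mult.assoc)
      also have "(\<Sum>i<d. \<Sum>j<d. of_int (c j) * (\<beta> (b j) i * v i k)) = (\<Sum>j<d. of_int (c j) * lincomb d v (\<beta> (b j)) k)"
        by (subst sum.swap) (simp add: lincomb_def sum_distrib_left)
      also have "\<dots> = (\<Sum>j<d. of_int (c j) * b j k)"
        by (intro sum.cong refl) (use \<beta> vec bL in auto)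
      finally show ?thesis .
    qed
    then have "lincomb d v t = (\<lambda>k. (\<Sum>j<d. of_int (c j) * b j k) + of_int 1 * (\<Sum>i<d. of_int (z i) * v i k))"
      by auto
    also have "\<dots> \<in> L" unfolding b
      by (intro lattice_of_add_scale lattice_of_int_comb) (use bL vL b in auto)
    finally show "t \<in> T" using t(1) by (simp add: T_def)
  next
    fix t assume "t \<in> T"
    then have t: "is_vec d t" "lincomb d v t \<in> L" by (auto simp: T_def)
    then obtain c :: "nat \<Rightarrow> int" where c: "lincomb d v t = (\<lambda>i. \<Sum>j<d. of_int (c j) * b j i)"
      unfolding b lattice_of_def by blast
    have "t i = (\<Sum>j<d. of_int (c j) * g j i) + of_int (\<Sum>j<d. c j * \<lfloor>\<beta> (b j) i\<rfloor>)" if "i < d" for i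
    proof -
      have "t i = (\<Sum>k<d. \<Sum>j<d. of_int (c j) * (u i k * b j k))"
        unfolding coord[OF that] c by (simp add: sum_distrib_left mult_ac)
      also have "\<dots> = (\<Sum>j<d. of_int (c j) * \<beta> (b j) i)"
        by (subst sum.swap) (simp add: \<beta>_def that sum_distrib_left)
      finally show ?thesis by (simp add: g_eq that right_diff_distrib sum_subtractf)
    qed
    then show "t \<in> coord_lattice d g" using t(1) unfolding coord_lattice_def
      by (intro CollectI conjI exI[of _ c] exI[of _ "\<lambda>i. \<Sum>j<d. c j * \<lfloor>\<beta> (b j) i\<rfloor>"]) auto
  qed
  \<comment> \<open>Quadratic forms are treated as vectors with one entry per index pair, so at most
    \<open>d*d\<close> minimal vectors suffice to detect them.\<close>
  let ?M = "min_vecs d L" and ?I = "{..<d} \<times> {..<d}"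
  obtain M0 where M0: "M0 \<subseteq> ?M" "finite M0" "card M0 \<le> card ?I"
    "\<And>B. \<forall>x\<in>M0. (\<Sum>p\<in>?I. x (fst p) * x (snd p) * B p) = 0 \<Longrightarrow>
       \<forall>x\<in>?M. (\<Sum>p\<in>?I. x (fst p) * x (snd p) * B p) = 0"
    using small_separating_subset[of ?I ?M "\<lambda>x p. x (fst p) * x (snd p)"] by blast
  have sep0: "\<forall>i<d. \<forall>j<d. B i j = 0"
    if "\<forall>i<d. \<forall>j<d. B i j = B j i" "\<And>x. x \<in> M0 \<Longrightarrow> (\<Sum>i<d. \<Sum>j<d. B i j * x i * x j) = 0" for B
  proof (rule perfect_separates[OF assms(2) that(1)])
    have *: "(\<Sum>p\<in>?I. x (fst p) * x (snd p) * B (fst p) (snd p)) = (\<Sum>i<d. \<Sum>j<d. B i j * x i * x j)" for x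
      unfolding sum.cartesian_product by (intro sum.cong) (auto simp: mult_ac)
    fix x assume "x \<in> ?M"
    then show "(\<Sum>i<d. \<Sum>j<d. B i j * x i * x j) = 0"
      using M0(4)[of "\<lambda>p. B (fst p) (snd p)"] that(2) unfolding * by blast
  qed
  have "M0 \<noteq> {}" using sep0[of "\<lambda>_ _. 1"] assms(3) by auto
  then obtain f where f: "f ` {..<d*d} = M0"
    using finite_surj_lessThan[OF M0(2), of "d*d"] M0(3) by (auto simp: card_cartesian_product)
  have fM: "f k \<in> ?M" if "k < d * d" for k using f M0(1) that by blast
  define W where "W = restrict (\<lambda>k. \<beta> (f k)) {..<d*d}"
  have W: "W k = \<beta> (f k)" "lincomb d v (W k) = f k" if "k < d * d" for k
    using that \<beta>[of "f k"] fM[OF that] vec by (auto simp: W_def min_vecs_def)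
  have W_in: "W \<in> {..<d*d} \<rightarrow>\<^sub>E coord_lattice d g \<inter> unit_box d"
  proof -
    have "\<beta> (f k) \<in> T \<inter> unit_box d" if "k < d * d" for k
      using \<beta>T[of "f k"] \<beta>_vec fM[OF that] small[of "f k"] by (auto simp: unit_box_def \<beta>_def min_vecs_def)
    then show ?thesis unfolding W_def T_eq by simp
  qed
  have "realizes_by d L g W v m" unfolding realizes_by_def
  proof (intro conjI allI impI)
    show "\<exists>u. dual_basis d v u" using u by blast
    show "is_vec d (v j)" if "j < d" for j using vL vec that by blast
    show "m > 0" by (rule m(1))
    show "L = lincomb d v ` coord_lattice d g" unfolding T_eq
    proof (intro equalityI subsetI)
      fix x assume "x \<in> L"
      then show "x \<in> lincomb d v ` T" using \<beta> vec \<beta>T by (intro image_eqI[of _ _ "\<beta> x"]) auto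
    qed (auto simp: T_def)
    show "ip d (lincomb d v (W k)) (lincomb d v (W k)) = m" if "k < d * d" for k
      using W(2)[OF that] m(2) fM[OF that] by simp
    fix B i0 j0 assume B: "\<forall>i<d. \<forall>j<d. B i j = B j i"
      "\<forall>k<d*d. (\<Sum>i<d. \<Sum>j<d. B i j * W k i * W k j) = 0" and ij: "i0 < d" "j0 < d"
    \<comment> \<open>\<open>B\<close> pulled back along the coordinate map: its value at a minimal
      vector \<open>f k\<close> is the value of \<open>B\<close> at \<open>W k\<close>.\<close>
    define A where "A = (\<lambda>a b. \<Sum>i<d. \<Sum>j<d. B i j * u i a * u j b)"
    have "\<forall>a<d. \<forall>b<d. A a b = 0"
    proof (rule sep0)
      have "A a b = A b a" for a b
      proof -
        have "A a b = (\<Sum>j<d. \<Sum>i<d. B i j * u i a * u j b)" unfolding A_def by (rule sum.swap)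
        also have "\<dots> = A b a" unfolding A_def by (intro sum.cong refl) (use B(1) in \<open>auto simp: mult_ac\<close>)
        finally show ?thesis .
      qed
      then show "\<forall>a<d. \<forall>b<d. A a b = A b a" by blast
      fix x assume "x \<in> M0"
      then obtain k where k: "k < d * d" "x = f k" using f by blast
      have "(\<Sum>a<d. \<Sum>b<d. A a b * x a * x b)
          = (\<Sum>i<d. \<Sum>j<d. B i j * (\<Sum>a<d. u i a * x a) * (\<Sum>b<d. u j b * x b))"
        unfolding A_def by (rule bilinear_pullback)
      also have "\<dots> = (\<Sum>i<d. \<Sum>j<d. B i j * W k i * W k j)"
        by (intro sum.cong refl) (simp add: W(1)[OF k(1)] \<beta>_def k(2))
      finally show "(\<Sum>a<d. \<Sum>b<d. A a b * x a * x b) = 0" using B(2) k(1) by simp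
    qed
    \<comment> \<open>Basis vectors have unit coordinate vectors, so evaluating \<open>A\<close> at
      \<open>v i0\<close> and \<open>v j0\<close> returns the entry of \<open>B\<close>.\<close>
    then have "0 = (\<Sum>a<d. \<Sum>b<d. A a b * v i0 a * v j0 b)" by simp
    also have "\<dots> = (\<Sum>i<d. \<Sum>j<d. B i j * (\<Sum>a<d. u i a * v i0 a) * (\<Sum>b<d. u j b * v j0 b))"
      unfolding A_def by (rule bilinear_pullback)
    also have "\<dots> = (\<Sum>i<d. \<Sum>j<d. if j = j0 then (if i = i0 then B i j else 0) else 0)"
      by (intro sum.cong refl) (use u ij in \<open>auto simp: dual_basis_def\<close>)
    also have "\<dots> = B i0 j0" using ij by simp
    finally show "B i0 j0 = 0" by simp
  qed
  then have "realizes d L g W" unfolding realizes_def by blast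
  then show ?thesis using g_in W_in few unfolding T_eq[symmetric] by blast
qed

lemma perfect_classes_bound:
  assumes "d > 0"
  defines "r \<equiv> {(L, L'). L \<in> perfect_prim_lattices d \<and> L' \<in> perfect_prim_lattices d \<and> lattice_iso d L L'}"
  shows "finite (perfect_prim_lattices d // r) \<and>
    card (perfect_prim_lattices d // r) \<le> (2 * d + 3) ^ (3 * d ^ 3)"
proof -
  define K :: nat where "K = (2 * d + 3) ^ d"
  let ?P = "perfect_prim_lattices d"
  let ?C = "\<lambda>g. coord_lattice d g \<inter> unit_box d"
  define G where "G = ({..<d} \<rightarrow>\<^sub>E {..<d} \<rightarrow>\<^sub>E fractions_upto K)"
  \<comment> \<open>The range of \<open>W\<close> depends on \<open>g\<close>, hence a dependent
    sum. Keeping only those \<open>g\<close> with at most \<open>K\<close> points in the box bounds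
    every fibre.\<close>
  define D where "D = (SIGMA g : {g \<in> G. finite (?C g) \<and> card (?C g) \<le> K}. ({..<d*d} \<rightarrow>\<^sub>E ?C g))"
  note Q = card_fractions_upto[of K]
  have finG: "finite G" unfolding G_def using Q by (intro finite_PiE) auto
  have cardG: "card G \<le> K ^ (2 * d\<^sup>2)"
  proof -
    have "card G = (card (fractions_upto K) ^ d) ^ d" unfolding G_def by (simp add: card_PiE)
    also have "\<dots> \<le> ((K * K) ^ d) ^ d" using Q by (intro power_mono) auto
    also have "\<dots> = K ^ (2 * d\<^sup>2)" by (simp add: power_mult power2_eq_square)
    finally show ?thesis .
  qed
  have finD: "finite D" unfolding D_def using finG by (intro finite_SigmaI finite_PiE) auto
  have "card D = (\<Sum>g\<in>{g \<in> G. finite (?C g) \<and> card (?C g) \<le> K}. card ({..<d*d} \<rightarrow>\<^sub>E ?C g))"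
    unfolding D_def using finG by (intro card_SigmaI) (auto intro!: finite_PiE)
  also have "\<dots> \<le> (\<Sum>g\<in>{g \<in> G. finite (?C g) \<and> card (?C g) \<le> K}. K ^ (d * d))"
    by (intro sum_mono) (auto simp: card_PiE intro!: power_mono)
  also have "\<dots> \<le> card G * K ^ (d * d)"
    using finG by (auto intro!: mult_right_mono card_mono)
  also have "\<dots> \<le> K ^ (2 * d\<^sup>2) * K ^ (d * d)" by (intro mult_right_mono cardG) simp
  also have "\<dots> = (2 * d + 3) ^ (3 * d ^ 3)"
    unfolding K_def by (simp add: power_add[symmetric] power_mult[symmetric] power2_eq_square power3_eq_cube algebra_simps)
  finally have cardD: "card D \<le> (2 * d + 3) ^ (3 * d ^ 3)" .
  define rep where "rep = (\<lambda>X. SOME L. L \<in> ?P \<and> X = r `` {L})"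
  have rep: "rep X \<in> ?P" "X = r `` {rep X}" if "X \<in> ?P // r" for X
  proof -
    have "\<exists>L. L \<in> ?P \<and> X = r `` {L}" using that by (auto simp: quotient_def)
    then have "rep X \<in> ?P \<and> X = r `` {rep X}" unfolding rep_def by (rule someI_ex)
    then show "rep X \<in> ?P" "X = r `` {rep X}" by auto
  qed
  have "\<exists>p\<in>D. realizes d (rep X) (fst p) (snd p)" if X: "X \<in> ?P // r" for X
  proof -
    have "is_lattice d (rep X)" "perfect d (rep X)"
      using rep(1)[OF X] unfolding perfect_prim_lattices_def by auto
    from realizes_exists[OF this assms(1)] obtain g W where
      "g \<in> G" "finite (?C g)" "card (?C g) \<le> K" "W \<in> ({..<d*d} \<rightarrow>\<^sub>E ?C g)" "realizes d (rep X) g W"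
      unfolding G_def K_def by blast
    then show ?thesis unfolding D_def by (intro bexI[of _ "(g, W)"]) auto
  qed
  then obtain F where F: "\<And>X. X \<in> ?P // r \<Longrightarrow> F X \<in> D"
    "\<And>X. X \<in> ?P // r \<Longrightarrow> realizes d (rep X) (fst (F X)) (snd (F X))" by metis
  have sub: "r `` {L'} \<subseteq> r `` {L}" if "L \<in> ?P" "lattice_iso d L L'" for L L'
    using that lattice_iso_trans unfolding r_def by auto
  have "inj_on F (?P // r)"
  proof (rule inj_onI)
    fix X Y assume XY: "X \<in> ?P // r" "Y \<in> ?P // r" "F X = F Y"
    have prim: "prim_integral d (rep X)" "prim_integral d (rep Y)"
      using rep(1) XY unfolding perfect_prim_lattices_def by auto
    have "realizes d (rep X) (fst (F X)) (snd (F X))" "realizes d (rep Y) (fst (F X)) (snd (F X))"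
      using F(2)[OF XY(1)] F(2)[OF XY(2)] XY(3) by simp_all
    \<comment> \<open>Equal data are symmetric in the two lattices, so isometries exist both ways;
      with transitivity this gives equal classes.\<close>
    then have "lattice_iso d (rep X) (rep Y)" "lattice_iso d (rep Y) (rep X)"
      using realizes_iso prim by blast+
    then have "r `` {rep X} = r `` {rep Y}" using sub rep(1) XY by (intro equalityI) auto
    then show "X = Y" using rep(2) XY by simp
  qed
  moreover have "F ` (?P // r) \<subseteq> D" using F(1) by blast
  ultimately have "finite (?P // r)" "card (?P // r) \<le> card D"
    using inj_on_finite card_inj_on_le finD by blast+
  then show ?thesis using cardD by auto
qed

section \<open>Lattices from point sets\<close>

text \<open>Builds a triangular basis: \<open>e j\<close> has last nonzero entry at
  \<open>j\<close>, and that entry divides every possible last entry there. It is 1 if an odd one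
  occurs, after reduction by a multiple of 2e_j, and 2 otherwise.\<close>

lemma is_lattice_int_vecs:
  fixes V :: "(nat \<Rightarrow> int) set"
  assumes vec: "\<And>c i. c \<in> V \<Longrightarrow> i \<ge> d \<Longrightarrow> c i = 0"
    and closed: "\<And>c e z. c \<in> V \<Longrightarrow> e \<in> V \<Longrightarrow> (\<lambda>i. c i + z * e i) \<in> V"
    and zero: "(\<lambda>_. 0) \<in> V"
    and two: "\<And>j. j < d \<Longrightarrow> (\<lambda>i. if i = j then 2 else 0) \<in> V"
  shows "is_lattice d ((\<lambda>c i. real_of_int (c i)) ` V)"
proof -
  have "\<exists>e\<in>V. (\<forall>i>j. e i = 0) \<and> e j \<noteq> 0 \<and> (\<forall>c\<in>V. (\<forall>i>j. c i = 0) \<longrightarrow> e j dvd c j)" if "j < d" for j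
  proof (cases "\<exists>c\<in>V. (\<forall>i>j. c i = 0) \<and> odd (c j)")
    case True
    then obtain c where c: "c \<in> V" "\<forall>i>j. c i = 0" "odd (c j)" by blast
    have "(\<lambda>i. c i + (- (c j div 2)) * (if i = j then 2 else 0)) \<in> V"
      by (rule closed[OF c(1) two[OF that]])
    moreover have "c j + (- (c j div 2)) * 2 = 1" using c(3) by presburger
    ultimately show ?thesis using c(2)
      by (intro bexI[of _ "\<lambda>i. c i + (- (c j div 2)) * (if i = j then 2 else 0)"]) simp_all
  next
    case False
    then show ?thesis using two[OF that] by (intro bexI[of _ "\<lambda>i. if i = j then 2 else 0"]) auto
  qed
  then have "\<forall>j\<in>{..<d}. \<exists>e. e \<in> V \<and> (\<forall>i>j. e i = 0) \<and> e j \<noteq> 0 \<and>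
      (\<forall>c\<in>V. (\<forall>i>j. c i = 0) \<longrightarrow> e j dvd c j)" by blast
  from bchoice[OF this] obtain e where "\<forall>j\<in>{..<d}. e j \<in> V \<and> (\<forall>i>j. e j i = 0) \<and> e j j \<noteq> 0 \<and>
      (\<forall>c\<in>V. (\<forall>i>j. c i = 0) \<longrightarrow> e j j dvd c j)" ..
  then have e: "\<And>j. j < d \<Longrightarrow> e j \<in> V" "\<And>j i. j < d \<Longrightarrow> i > j \<Longrightarrow> e j i = 0"
    "\<And>j. j < d \<Longrightarrow> e j j \<noteq> 0"
    "\<And>j c. j < d \<Longrightarrow> c \<in> V \<Longrightarrow> \<forall>i>j. c i = 0 \<Longrightarrow> e j j dvd c j" by simp_all
  have sum_in: "(\<lambda>i. \<Sum>j<n. z j * e j i) \<in> V" if "n \<le> d" for n z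
    using that
  proof (induction n)
    case (Suc n)
    then show ?case using closed[of "\<lambda>i. \<Sum>j<n. z j * e j i" "e n" "z n"] e(1)[of n] by simp
  qed (simp add: zero)
  have expand: "\<exists>z. c = (\<lambda>i. \<Sum>j<n. z j * e j i)" if "n \<le> d" "c \<in> V" "\<forall>i\<ge>n. c i = 0" for n c
    using that
  proof (induction n arbitrary: c)
    case (Suc n)
    have n: "n < d" using Suc.prems by simp
    obtain y where y: "c n = e n n * y"
      using e(4)[OF n Suc.prems(2)] Suc.prems(3) by (auto simp: Suc_le_eq elim: dvdE)
    \<comment> \<open>Clears the top entry, as in back substitution.\<close>
    define c' where "c' = (\<lambda>i. c i + (- y) * e n i)"
    have "c' \<in> V" unfolding c'_def by (rule closed[OF Suc.prems(2) e(1)[OF n]])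
    moreover have "\<forall>i\<ge>n. c' i = 0"
    proof (intro allI impI)
      fix i assume "n \<le> i"
      then consider "i = n" | "Suc n \<le> i" by linarith
      then show "c' i = 0" using Suc.prems(3) e(2)[OF n, of i] y unfolding c'_def by cases auto
    qed
    ultimately obtain z where z: "c' = (\<lambda>i. \<Sum>j<n. z j * e j i)"
      using Suc.IH[OF less_imp_le[OF n]] by blast
    have "c i = (\<Sum>j<Suc n. (z(n := y)) j * e j i)" for i
      using fun_cong[OF z, of i] unfolding c'_def by simp
    then show ?case by (intro exI[of _ "z(n := y)"]) (rule ext)
  qed auto
  define b where "b = (\<lambda>j i. real_of_int (e j i))"
  have indep: "\<forall>j<d. x j = 0" if x: "(\<lambda>i. \<Sum>j<d. x j * b j i) = (\<lambda>i. 0)" for x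
  proof (rule ccontr)
    assume no: "\<not> (\<forall>j<d. x j = 0)"
    define A where "A = {j. j < d \<and> x j \<noteq> 0}"
    have A: "finite A" "A \<noteq> {}" using no unfolding A_def by auto
    define l where "l = Max A"
    have l: "l < d" "x l \<noteq> 0" using Max_in[OF A] unfolding l_def A_def by auto
    have "x j = 0" if "l < j" "j < d" for j
    proof (rule ccontr)
      assume "x j \<noteq> 0"
      then have "j \<le> l" using that A(1) unfolding l_def by (intro Max_ge) (auto simp: A_def)
      then show False using that by simp
    qed
    then have "(\<Sum>j<d. x j * b j l) = (\<Sum>j<d. if j = l then x l * b l l else 0)"
      using e(2) by (intro sum.cong refl) (auto simp: b_def nat_neq_iff)
    then have "x l * b l l = 0" using fun_cong[OF x, of l] l(1) by simp
    then show False using l e(3)[OF l(1)] by (simp add: b_def)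
  qed
  have "(\<lambda>c i. real_of_int (c i)) ` V = lattice_of d b"
  proof (intro equalityI subsetI)
    fix x assume "x \<in> (\<lambda>c i. real_of_int (c i)) ` V"
    then obtain c where c: "c \<in> V" "x = (\<lambda>i. real_of_int (c i))" by blast
    then obtain z where "c = (\<lambda>i. \<Sum>j<d. z j * e j i)" using expand[of d c] vec by auto
    then have "x = (\<lambda>i. \<Sum>j<d. of_int (z j) * b j i)" unfolding c(2) b_def by simp
    then show "x \<in> lattice_of d b" unfolding lattice_of_def by (intro CollectI exI[of _ z])
  next
    fix x assume "x \<in> lattice_of d b"
    then obtain z :: "nat \<Rightarrow> int" where x: "x = (\<lambda>i. \<Sum>j<d. of_int (z j) * b j i)"
      unfolding lattice_of_def by blast
    show "x \<in> (\<lambda>c i. real_of_int (c i)) ` V"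
      by (rule image_eqI[OF _ sum_in[of d z]]) (simp_all add: x b_def)
  qed
  moreover have "\<forall>j<d. is_vec d (b j)" using e(1) vec by (auto simp: is_vec_def b_def)
  ultimately show ?thesis unfolding is_lattice_def using indep by (intro exI[of _ b]) blast
qed

section \<open>Construction A on point sets of F_2^n and its minimal vectors\<close>

text \<open>Points of \<open>F\<^sub>2\<^sup>n\<close> are subsets of \<open>{..<n}\<close>; \<open>tri\<close> is the sum of three points.\<close>

definition tri :: "nat set \<Rightarrow> nat set \<Rightarrow> nat set \<Rightarrow> nat set" where
  "tri a b c = {k. k \<in> a \<longleftrightarrow> (k \<in> b \<longleftrightarrow> k \<in> c)}"

text \<open>Construction A: the plain sum tests the constant function, the others the coordinate
  functions. For points inside \<open>{..<n}\<close> the conditions with \<open>k \<ge> n\<close>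
  hold trivially, so \<open>n\<close> need not be a parameter.\<close>

definition code_vecs :: "nat \<Rightarrow> (nat \<Rightarrow> nat set) \<Rightarrow> (nat \<Rightarrow> int) set" where
  "code_vecs d f = {c. (\<forall>i\<ge>d. c i = 0) \<and> even (\<Sum>i<d. c i) \<and>
     (\<forall>k. even (\<Sum>i<d. of_bool (k \<in> f i) * c i))}"

definition code_lattice :: "nat \<Rightarrow> (nat \<Rightarrow> nat set) \<Rightarrow> (nat \<Rightarrow> real) set" where
  "code_lattice d f = (\<lambda>c i. real_of_int (c i)) ` code_vecs d f"

definition quad_comb :: "nat \<Rightarrow> nat \<Rightarrow> nat \<Rightarrow> nat \<Rightarrow> int \<Rightarrow> int \<Rightarrow> int \<Rightarrow> int \<Rightarrow> nat \<Rightarrow> int" where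
  "quad_comb p q r s a b c e = (\<lambda>i. if i = p then a else if i = q then b else if i = r then c
     else if i = s then e else 0)"

lemma code_vecs_two: "j < d \<Longrightarrow> (\<lambda>i. if i = j then 2 else 0) \<in> code_vecs d f"
  by (auto simp: code_vecs_def intro!: dvd_sum)

lemma code_lattice_is_lattice: "is_lattice d (code_lattice d f)"
  unfolding code_lattice_def
proof (rule is_lattice_int_vecs)
  show "c i = 0" if "c \<in> code_vecs d f" "i \<ge> d" for c i using that by (simp add: code_vecs_def)
  show "(\<lambda>_. 0) \<in> code_vecs d f" by (simp add: code_vecs_def)
  show "(\<lambda>i. if i = j then 2 else 0) \<in> code_vecs d f" if "j < d" for j using code_vecs_two[OF that] .
  fix c e z assume "c \<in> code_vecs d f" "e \<in> code_vecs d f"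
  moreover have "(\<Sum>i<d. g i * (c i + z * e i)) = (\<Sum>i<d. g i * c i) + z * (\<Sum>i<d. g i * e i)" for g
    by (simp add: distrib_left sum.distrib sum_distrib_left mult_ac)
  from this[of "\<lambda>_. 1"] this have "(\<Sum>i<d. c i + z * e i) = (\<Sum>i<d. c i) + z * (\<Sum>i<d. e i)"
    "\<And>k. (\<Sum>i<d. of_bool (k \<in> f i) * (c i + z * e i)) =
       (\<Sum>i<d. of_bool (k \<in> f i) * c i) + z * (\<Sum>i<d. of_bool (k \<in> f i) * e i)" by simp_all
  ultimately show "(\<lambda>i. c i + z * e i) \<in> code_vecs d f" by (simp add: code_vecs_def)
qed

text \<open>Stated over a general ring because it serves both integer parity sums and the real rows
  of an isometry.\<close>

lemma sum_quad_comb: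
  fixes g :: "nat \<Rightarrow> 'a::comm_ring_1"
  assumes "distinct [p, q, r, s]" "p < d" "q < d" "r < d" "s < d"
  shows "(\<Sum>i<d. g i * of_int (quad_comb p q r s a b c e i))
    = g p * of_int a + g q * of_int b + g r * of_int c + g s * of_int e"
proof -
  have "(\<Sum>i<d. g i * of_int (quad_comb p q r s a b c e i)) = (\<Sum>i\<in>{p, q, r, s}. g i * of_int (quad_comb p q r s a b c e i))"
    using assms by (intro sum.mono_neutral_right) (auto simp: quad_comb_def)
  then show ?thesis using assms(1) by (simp add: quad_comb_def add.assoc)
qed

lemma even_four:
  "even (of_bool P + of_bool Q + of_bool R + of_bool S :: int) \<longleftrightarrow> (S \<longleftrightarrow> (P \<longleftrightarrow> (Q \<longleftrightarrow> R)))"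
  by (cases P; cases Q; cases R; cases S) auto

text \<open>Odd coefficients count as 1 modulo 2. The constant function then sees four ones, and the
  coordinate functions say that the four points sum to zero.\<close>

lemma quad_comb_in_code_vecs_iff:
  assumes "distinct [p, q, r, s]" "p < d" "q < d" "r < d" "s < d" "odd a" "odd b" "odd c" "odd e"
  shows "quad_comb p q r s a b c e \<in> code_vecs d f \<longleftrightarrow> f s = tri (f p) (f q) (f r)"
proof -
  have "even (\<Sum>i<d. of_bool (k \<in> f i) * quad_comb p q r s a b c e i) \<longleftrightarrow>
      even (of_bool (k \<in> f p) + of_bool (k \<in> f q) + of_bool (k \<in> f r) + of_bool (k \<in> f s) :: int)" for k
    using sum_quad_comb[OF assms(1-5), where g = "\<lambda>i. of_bool (k \<in> f i) :: int" and a = a and b = b and c = c and e = e]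
      assms(6-9) by simp
  then have "even (\<Sum>i<d. of_bool (k \<in> f i) * quad_comb p q r s a b c e i) \<longleftrightarrow> (k \<in> f s \<longleftrightarrow> k \<in> tri (f p) (f q) (f r))" for k
    unfolding even_four tri_def by simp
  moreover have "even (\<Sum>i<d. quad_comb p q r s a b c e i)"
    using sum_quad_comb[OF assms(1-5), where g = "\<lambda>i. 1 :: int" and a = a and b = b and c = c and e = e]
      assms(6-9) by simp
  moreover have "\<forall>i\<ge>d. quad_comb p q r s a b c e i = 0" using assms(2-5) by (auto simp: quad_comb_def)
  ultimately show ?thesis by (auto simp: code_vecs_def)
qed

text \<open>For injective \<open>f\<close> these are the affine planes of F_2^n contained in the
  point set.\<close>

definition is_quad :: "nat \<Rightarrow> (nat \<Rightarrow> nat set) \<Rightarrow> nat \<Rightarrow> nat \<Rightarrow> nat \<Rightarrow> nat \<Rightarrow> bool" where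
  "is_quad d f p q r s \<longleftrightarrow> p < d \<and> q < d \<and> r < d \<and> s < d \<and> distinct [p, q, r, s] \<and>
     f s = tri (f p) (f q) (f r)"

definition quad_vec :: "nat \<Rightarrow> (nat \<Rightarrow> nat set) \<Rightarrow> (nat \<Rightarrow> int) \<Rightarrow> bool" where
  "quad_vec d f c \<longleftrightarrow> (\<exists>p q r s. is_quad d f p q r s \<and>
     (\<exists>a\<in>{1, -1}. \<exists>b\<in>{1, -1}. \<exists>a'\<in>{1, -1}. \<exists>b'\<in>{1, -1}. c = quad_comb p q r s a b a' b'))"

text \<open>An entry of absolute value at least 2 already contributes 4. Otherwise all entries are 0
  or \<plusminus>1 and the support has even size by the constant function; size 2 would identify two
  points, so the size is at least 4, and size 4 is a quadruple with sum zero.\<close>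

lemma code_vecs_norm:
  assumes c: "c \<in> code_vecs d f" and nz: "c \<noteq> (\<lambda>_. 0)" and inj: "inj_on f {..<d}"
  shows "4 \<le> (\<Sum>i<d. (c i)\<^sup>2)"
    and "(\<Sum>i<d. (c i)\<^sup>2) = 4 \<Longrightarrow>
      (\<exists>j<d. \<exists>a\<in>{1, -1}. c = (\<lambda>i. if i = j then 2 * a else 0)) \<or>
      quad_vec d f c"
    (is "_ \<Longrightarrow> ?A \<or> ?B")
proof -
  have supp: "c i = 0" if "i \<ge> d" for i using c that by (simp add: code_vecs_def)
  have "4 \<le> (\<Sum>i<d. (c i)\<^sup>2) \<and> ((\<Sum>i<d. (c i)\<^sup>2) = 4 \<longrightarrow> ?A \<or> ?B)"
  proof (cases "\<exists>j<d. \<bar>c j\<bar> \<ge> 2")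
    case True
    then obtain j where j: "j < d" "\<bar>c j\<bar> \<ge> 2" by blast
    have sq: "(c j)\<^sup>2 \<ge> 4" using power_mono[OF j(2), of 2] by simp
    have split: "(\<Sum>i<d. (c i)\<^sup>2) = (c j)\<^sup>2 + (\<Sum>i\<in>{..<d} - {j}. (c i)\<^sup>2)"
      using j(1) by (simp add: sum.remove)
    have rest: "(\<Sum>i\<in>{..<d} - {j}. (c i)\<^sup>2) \<ge> 0" by (intro sum_nonneg) simp
    have "?A \<or> ?B" if eq: "(\<Sum>i<d. (c i)\<^sup>2) = 4"
    proof -
      have "(\<Sum>i\<in>{..<d} - {j}. (c i)\<^sup>2) = 0" "(c j)\<^sup>2 = 4" using sq split rest eq by linarith+
      then have "\<forall>i\<in>{..<d} - {j}. (c i)\<^sup>2 = 0" by (subst (asm) sum_nonneg_eq_0_iff) auto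
      then have other: "c i = 0" if "i \<noteq> j" for i using supp[of i] that by (cases "i < d") auto
      have "(c j)\<^sup>2 = 2\<^sup>2" using \<open>(c j)\<^sup>2 = 4\<close> by simp
      then obtain a where a: "a \<in> {1, -1}" "c j = 2 * a" unfolding power2_eq_iff by fastforce
      then have "c = (\<lambda>i. if i = j then 2 * a else 0)" using other by (intro ext) simp
      then have ?A using a(1) j(1) by blast
      then show ?thesis ..
    qed
    moreover have "4 \<le> (\<Sum>i<d. (c i)\<^sup>2)" using sq split rest by linarith
    ultimately show ?thesis by blast
  next
    case False
    have vals: "c i = 0 \<or> c i = 1 \<or> c i = -1" for i
    proof (cases "i < d")
      case True
      then have "\<bar>c i\<bar> < 2" using False by auto
      then show ?thesis by linarith
    qed (simp add: supp)
    have sq1: "(c i)\<^sup>2 = 1" if "c i \<noteq> 0" for i using vals[of i] that by auto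
    define A where "A = {i. i < d \<and> c i \<noteq> 0}"
    have finA: "finite A" by (simp add: A_def)
    have restr: "(\<Sum>i<d. g i) = (\<Sum>i\<in>A. g i)" if "\<And>i. c i = 0 \<Longrightarrow> g i = 0" for g :: "nat \<Rightarrow> int"
      using that by (intro sum.mono_neutral_right) (auto simp: A_def)
    have "(\<Sum>i<d. (c i)\<^sup>2) = (\<Sum>i\<in>A. (c i)\<^sup>2)" by (rule restr) simp
    also have "\<dots> = (\<Sum>i\<in>A. 1)" by (intro sum.cong refl) (simp add: A_def sq1)
    finally have norm: "(\<Sum>i<d. (c i)\<^sup>2) = int (card A)" by simp
    have parity: "even (\<Sum>i\<in>A. g i)" if "even (\<Sum>i<d. g i * c i)" for g
    proof -
      have "(\<Sum>i<d. g i * c i) = (\<Sum>i\<in>A. g i * c i)" by (rule restr) simp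
      moreover have "even (\<Sum>i\<in>A. g i * c i - g i)"
      proof (intro dvd_sum)
        fix i assume "i \<in> A"
        then have "c i = 1 \<or> c i = -1" using vals[of i] by (auto simp: A_def)
        then show "even (g i * c i - g i)" by auto
      qed
      ultimately show ?thesis using that by (simp add: sum_subtractf)
    qed
    have "even (card A)" using parity[of "\<lambda>_. 1"] c by (simp add: code_vecs_def)
    have bits: "even (\<Sum>i\<in>A. of_bool (k \<in> f i) :: int)" for k
      using parity[of "\<lambda>i. of_bool (k \<in> f i)"] c by (simp add: code_vecs_def)
    have "A \<noteq> {}"
    proof
      assume "A = {}"
      then have "c i = 0" for i using supp[of i] by (cases "i < d") (auto simp: A_def)
      then show False using nz by auto
    qed
    then have "card A \<noteq> 0" using finA by simp
    moreover have "card A \<noteq> 2"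
    proof
      assume "card A = 2"
      then obtain p q where pq: "A = {p, q}" "p \<noteq> q" by (auto simp: card_2_iff)
      have "k \<in> f p \<longleftrightarrow> k \<in> f q" for k
        using bits[of k] unfolding pq(1) using pq(2) by (cases "k \<in> f p"; cases "k \<in> f q") auto
      then have "f p = f q" by blast
      moreover have "p < d" "q < d" using pq(1) by (auto simp: A_def)
      ultimately show False using inj pq(2) by (auto simp: inj_on_def)
    qed
    ultimately have "card A \<ge> 4" using \<open>even (card A)\<close> by presburger
    moreover have ?B if c4: "card A = 4"
    proof -
      obtain p A1 where 1: "A = insert p A1" "p \<notin> A1" "card A1 = 3"
        using c4 card_Suc_eq[of A 3] by auto
      obtain q A2 where 2: "A1 = insert q A2" "q \<notin> A2" "card A2 = 2"
        using 1(3) card_Suc_eq[of A1 2] by auto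
      obtain r s where 3: "A2 = {r, s}" "r \<noteq> s" using 2(3) by (auto simp: card_2_iff)
      have A: "A = {p, q, r, s}" and dist: "distinct [p, q, r, s]" using 1 2 3 by auto
      have lt: "p < d" "q < d" "r < d" "s < d" using A by (auto simp: A_def)
      have "(\<Sum>i\<in>{p, q, r, s}. g i) = g p + g q + g r + g s" for g :: "nat \<Rightarrow> int"
        using dist by (simp add: add.assoc)
      then have "even (of_bool (k \<in> f p) + of_bool (k \<in> f q) + of_bool (k \<in> f r) + of_bool (k \<in> f s) :: int)" for k
        using bits[of k] unfolding A by metis
      then have "f s = tri (f p) (f q) (f r)" unfolding even_four tri_def by blast
      moreover have "c i = quad_comb p q r s (c p) (c q) (c r) (c s) i" for i
      proof (cases "i \<in> A")
        case False
        then have "c i = 0" using supp[of i] by (cases "i < d") (auto simp: A_def)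
        then show ?thesis using False unfolding A by (simp add: quad_comb_def)
      qed (auto simp: A quad_comb_def)
      then have "c = quad_comb p q r s (c p) (c q) (c r) (c s)" by (rule ext)
      moreover have "c i \<in> {1, -1}" if "i \<in> A" for i using vals[of i] that by (auto simp: A_def)
      then have "c p \<in> {1, -1}" "c q \<in> {1, -1}" "c r \<in> {1, -1}" "c s \<in> {1, -1}" unfolding A by blast+
      ultimately show ?B unfolding quad_vec_def is_quad_def using lt dist by blast
    qed
    ultimately have "4 \<le> int (card A) \<and> (int (card A) = 4 \<longrightarrow> ?B)" by simp
    then show ?thesis unfolding norm by blast
  qed
  then show "4 \<le> (\<Sum>i<d. (c i)\<^sup>2)" "(\<Sum>i<d. (c i)\<^sup>2) = 4 \<Longrightarrow> ?A \<or> ?B" by blast+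
qed

lemma ip_of_int: "ip d (\<lambda>i. real_of_int (c i)) (\<lambda>i. real_of_int (e i)) = of_int (\<Sum>i<d. c i * e i)"
  by (simp add: ip_def)

lemma is_quad_quad_comb:
  assumes "is_quad d f p q r s" "odd a" "odd b" "odd c" "odd e"
  shows "quad_comb p q r s a b c e \<in> code_vecs d f"
  using assms quad_comb_in_code_vecs_iff[of p q r s d a b c e f] by (simp add: is_quad_def)

lemma sum_quad_comb_square:
  assumes "is_quad d f p q r s"
  shows "(\<Sum>i<d. (quad_comb p q r s a b c e i)\<^sup>2) = a\<^sup>2 + b\<^sup>2 + c\<^sup>2 + e\<^sup>2"
proof -
  have d: "distinct [p, q, r, s]" "p < d" "q < d" "r < d" "s < d" using assms by (auto simp: is_quad_def)
  have "(\<Sum>i<d. quad_comb p q r s a b c e i * of_int (quad_comb p q r s a b c e i)) = a * a + b * b + c * c + e * e"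
    unfolding sum_quad_comb[OF d] using d(1) by (simp add: quad_comb_def)
  then show ?thesis by (simp add: power2_eq_square)
qed

lemma code_min_vecsI:
  assumes "c \<in> code_vecs d f" "(\<Sum>i<d. (c i)\<^sup>2) = 4" "inj_on f {..<d}"
  shows "(\<lambda>i. real_of_int (c i)) \<in> min_vecs d (code_lattice d f)"
  unfolding min_vecs_def
proof (intro CollectI conjI ballI impI)
  show "(\<lambda>i. real_of_int (c i)) \<in> code_lattice d f" using assms(1) by (simp add: code_lattice_def)
  show "(\<lambda>i. real_of_int (c i)) \<noteq> (\<lambda>i. 0)"
  proof
    assume 0: "(\<lambda>i. real_of_int (c i)) = (\<lambda>i. 0)"
    have "c i = 0" for i using fun_cong[OF 0, of i] by simp
    then show False using assms(2) by simp
  qed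
  fix w assume "w \<in> code_lattice d f" "w \<noteq> (\<lambda>i. 0)"
  then obtain e where e: "e \<in> code_vecs d f" "w = (\<lambda>i. real_of_int (e i))" "e \<noteq> (\<lambda>_. 0)"
    by (auto simp: code_lattice_def)
  have "4 \<le> (\<Sum>i<d. e i * e i)" using code_vecs_norm(1)[OF e(1,3) assms(3)] by (simp add: power2_eq_square)
  then show "ip d (\<lambda>i. real_of_int (c i)) (\<lambda>i. real_of_int (c i)) \<le> ip d w w"
    using assms(2) unfolding e(2) ip_of_int by (simp only: of_int_le_iff power2_eq_square)
qed

lemma code_min_vecs_two:
  assumes "j < d" "inj_on f {..<d}"
  shows "(\<lambda>i. real_of_int (if i = j then 2 else 0)) \<in> min_vecs d (code_lattice d f)"
  by (rule code_min_vecsI[OF code_vecs_two[OF assms(1)] _ assms(2)])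
     (use assms(1) in \<open>simp add: if_distrib[of "\<lambda>x. x\<^sup>2"] cong: if_cong\<close>)

lemma code_min_vecsE:
  assumes "x \<in> min_vecs d (code_lattice d f)" "d > 0" "inj_on f {..<d}"
  obtains c where "x = (\<lambda>i. real_of_int (c i))" "c \<in> code_vecs d f" "c \<noteq> (\<lambda>_. 0)" "(\<Sum>i<d. (c i)\<^sup>2) = 4"
proof -
  from assms(1) obtain c where c: "x = (\<lambda>i. real_of_int (c i))" "c \<in> code_vecs d f" "c \<noteq> (\<lambda>_. 0)"
    by (auto simp: min_vecs_def code_lattice_def)
  \<comment> \<open>The vector 2e_0 caps the minimal norm at 4.\<close>
  define t where "t = (\<lambda>i::nat. real_of_int (if i = 0 then 2 else 0))"
  have "t \<in> min_vecs d (code_lattice d f)" unfolding t_def by (rule code_min_vecs_two[OF assms(2,3)])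
  then have t: "t \<in> code_lattice d f" "t \<noteq> (\<lambda>i. 0)" by (simp_all add: min_vecs_def)
  have "ip d x x \<le> ip d t t" using assms(1) t by (simp add: min_vecs_def)
  also have "ip d t t = (\<Sum>i<d. if i = 0 then 4 else 0)"
    unfolding ip_def t_def by (intro sum.cong) auto
  also have "\<dots> = 4" using assms(2) by simp
  finally have "real_of_int (\<Sum>i<d. c i * c i) \<le> real_of_int 4" unfolding c(1) ip_of_int by simp
  then have "(\<Sum>i<d. (c i)\<^sup>2) \<le> 4" unfolding of_int_le_iff power2_eq_square .
  then show thesis using that[OF c] code_vecs_norm(1)[OF c(2,3) assms(3)] by linarith
qed

text \<open>The sums in \<open>perfect\<close> would collapse to 0 over an infinite set; squares
  adding up to 4 confine the entries to \<open>{-2..2}\<close>.\<close>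

lemma code_min_vecs_finite:
  assumes "d > 0" "inj_on f {..<d}"
  shows "finite (min_vecs d (code_lattice d f))"
proof -
  let ?F = "{c::nat \<Rightarrow> int. \<forall>i. (i \<in> {..<d} \<longrightarrow> c i \<in> {-2..2}) \<and> (i \<notin> {..<d} \<longrightarrow> c i = 0)}"
  have "min_vecs d (code_lattice d f) \<subseteq> (\<lambda>c i. real_of_int (c i)) ` ?F"
  proof
    fix x assume "x \<in> min_vecs d (code_lattice d f)"
    then obtain c where c: "x = (\<lambda>i. real_of_int (c i))" "c \<in> code_vecs d f" "(\<Sum>i<d. (c i)\<^sup>2) = 4"
      by (rule code_min_vecsE[OF _ assms])
    have "c i \<in> {-2..2}" if "i < d" for i
    proof -
      have "(c i)\<^sup>2 \<le> 2\<^sup>2" using member_le_sum[of i "{..<d}" "\<lambda>i. (c i)\<^sup>2"] that c(3) by simp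
      then have "\<bar>c i\<bar> \<le> 2" using abs_le_square_iff[of "c i" 2] by simp
      then show ?thesis by auto
    qed
    then have "c \<in> ?F" using c(2) by (simp add: code_vecs_def)
    then show "x \<in> (\<lambda>c i. real_of_int (c i)) ` ?F" using c(1) by blast
  qed
  moreover have "finite ?F" by (rule finite_set_of_finite_funs) simp_all
  ultimately show ?thesis by (rule finite_subset[OF _ finite_imageI])
qed

section \<open>Perfection and primitivity of the code lattices\<close>

definition tensor_span :: "nat \<Rightarrow> (nat \<Rightarrow> real) set \<Rightarrow> (nat \<Rightarrow> nat \<Rightarrow> real) set" where
  "tensor_span d M = {S. \<exists>a. \<forall>i<d. \<forall>j<d. S i j = (\<Sum>v\<in>M. a v * v i * v j)}"

lemma tensor_spanI: "(\<And>i j. i < d \<Longrightarrow> j < d \<Longrightarrow> S i j = (\<Sum>v\<in>M. a v * v i * v j)) \<Longrightarrow> S \<in> tensor_span d M"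
  unfolding tensor_span_def by blast

lemma tensor_span_lin:
  assumes "S \<in> tensor_span d M" "T \<in> tensor_span d M"
  shows "(\<lambda>i j. x * S i j + y * T i j) \<in> tensor_span d M"
proof -
  obtain a b where a: "\<And>i j. i < d \<Longrightarrow> j < d \<Longrightarrow> S i j = (\<Sum>v\<in>M. a v * v i * v j)"
    and b: "\<And>i j. i < d \<Longrightarrow> j < d \<Longrightarrow> T i j = (\<Sum>v\<in>M. b v * v i * v j)"
    using assms unfolding tensor_span_def by blast
  show ?thesis
    by (rule tensor_spanI[where a = "\<lambda>v. x * a v + y * b v"])
       (simp add: a b distrib_right sum.distrib sum_distrib_left mult.assoc)
qed

lemma tensor_span_sum:
  assumes "finite A" "\<And>p. p \<in> A \<Longrightarrow> S p \<in> tensor_span d M"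
  shows "(\<lambda>i j. \<Sum>p\<in>A. x p * S p i j) \<in> tensor_span d M"
  using assms
proof (induction A rule: finite_induct)
  case empty
  then show ?case by (intro tensor_spanI[where a = "\<lambda>_. 0"]) simp
next
  case (insert p A)
  then have "(\<lambda>i j. x p * S p i j + 1 * (\<Sum>p\<in>A. x p * S p i j)) \<in> tensor_span d M"
    by (intro tensor_span_lin) auto
  then show ?case using insert.hyps by simp
qed

lemma tensor_span_base:
  assumes "finite M" "v \<in> M"
  shows "(\<lambda>i j. v i * v j) \<in> tensor_span d M"
proof (rule tensor_spanI[where a = "\<lambda>w. if w = v then 1 else 0"])
  fix i j
  have "(\<Sum>w\<in>M. (if w = v then 1 else 0) * w i * w j) = (\<Sum>w\<in>M. if w = v then v i * v j else 0)"
    by (intro sum.cong) auto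
  then show "v i * v j = (\<Sum>w\<in>M. (if w = v then 1 else 0) * w i * w j)" using assms by simp
qed

text \<open>The 5 leaves room to exclude \<open>p\<close>, \<open>q\<close> and three more indices,
  as needed to make two quadruples meet in one index. \<open>5 \<le> d\<close> supplies an index
  outside any given quadruple.\<close>

definition quad_rich :: "nat \<Rightarrow> (nat \<Rightarrow> nat set) \<Rightarrow> bool" where
  "quad_rich d f \<longleftrightarrow> 5 \<le> d \<and> inj_on f {..<d} \<and>
     (\<forall>p<d. \<forall>q<d. p \<noteq> q \<longrightarrow> (\<forall>F. finite F \<and> card F \<le> 5 \<longrightarrow>
        (\<exists>r<d. \<exists>s<d. r \<notin> F \<and> s \<notin> F \<and> f s = tri (f p) (f q) (f r))))"

lemma quad_rich_quad:
  assumes "quad_rich d f" "p < d" "q < d" "p \<noteq> q" "finite F" "card F \<le> 3"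
  obtains r s where "is_quad d f p q r s" "r \<notin> F" "s \<notin> F"
proof -
  have "card (insert p (insert q F)) \<le> 5" using assms(5,6) by (simp add: card_insert_if)
  then obtain r s where rs: "r < d" "s < d" "r \<notin> insert p (insert q F)" "s \<notin> insert p (insert q F)"
    "f s = tri (f p) (f q) (f r)"
    using assms unfolding quad_rich_def by (metis finite_insert)
  have "r \<noteq> s"
  proof
    assume "r = s"
    then have "f p = f q" using rs(5) unfolding tri_def by blast
    then show False using assms(1-4) by (auto simp: quad_rich_def inj_on_def)
  qed
  then have "is_quad d f p q r s" using rs assms(2-4) by (auto simp: is_quad_def)
  then show thesis using that rs by blast
qed

text \<open>Vectors on two quadruples sharing only \<open>p\<close> have an odd inner product. This
  makes the lattice primitive and distinguishes quadruple vectors from \<plusminus>2e_i.\<close>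

lemma quad_rich_meet:
  assumes "quad_rich d f" "is_quad d f p q r s"
  obtains a b c where "is_quad d f p a b c" "a \<notin> {p, q, r, s}" "b \<notin> {p, q, r, s}" "c \<notin> {p, q, r, s}"
proof -
  have "\<exists>a<d. a \<notin> {p, q, r, s}"
  proof (rule ccontr)
    assume "\<not> ?thesis"
    then have "{..<d} \<subseteq> {p, q, r, s}" by blast
    then have "card {..<d} \<le> card {p, q, r, s}" by (intro card_mono) auto
    also have "\<dots> \<le> 4" by (simp add: card_insert_if)
    finally show False using assms(1) by (simp add: quad_rich_def)
  qed
  then obtain a where a: "a < d" "a \<notin> {p, q, r, s}" by blast
  moreover have "p < d" using assms(2) by (simp add: is_quad_def)
  moreover have "card {q, r, s} \<le> 3" by (simp add: card_insert_if)
  ultimately obtain b c where bc: "is_quad d f p a b c" "b \<notin> {q, r, s}" "c \<notin> {q, r, s}"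
    using quad_rich_quad[OF assms(1), of p a "{q, r, s}"] by auto
  then show thesis using that[OF bc(1)] a(2) by (auto simp: is_quad_def)
qed

lemma ip_quads_meet:
  assumes "is_quad d f p q r s" "is_quad d f p a b c" "a \<notin> {p, q, r, s}" "b \<notin> {p, q, r, s}" "c \<notin> {p, q, r, s}"
  shows "(\<Sum>i<d. quad_comb p q r s x y z t i * quad_comb p a b c 1 1 1 1 i) = x"
proof -
  have d: "distinct [p, a, b, c]" "p < d" "a < d" "b < d" "c < d" using assms(2) by (auto simp: is_quad_def)
  have "(\<Sum>i<d. quad_comb p q r s x y z t i * of_int (quad_comb p a b c 1 1 1 1 i)) = x"
    unfolding sum_quad_comb[OF d] using assms(3-5) d(1) by (auto simp: quad_comb_def)
  then show ?thesis by simp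
qed

text \<open>It suffices to span the matrices \<open>E (p, q)\<close>: the diagonal ones come from
  2e_p, the others by polarizing over sign changes on a quadruple through \<open>p\<close> and
  \<open>q\<close>.\<close>

lemma code_lattice_perfect:
  assumes "quad_rich d f"
  shows "perfect d (code_lattice d f)"
proof -
  let ?M = "min_vecs d (code_lattice d f)"
  have inj: "inj_on f {..<d}" and d0: "d > 0" using assms by (auto simp: quad_rich_def)
  note fin = code_min_vecs_finite[OF d0 inj]
  define E where "E = (\<lambda>(p::nat, q::nat) (i::nat) (j::nat).
    (if i = p \<and> j = q then 1 else 0) + (if i = q \<and> j = p then 1 else 0 :: real))"
  have E_in: "E (p, q) \<in> tensor_span d ?M" if pq: "p < d" "q < d" for p q
  proof (cases "p = q")
    case True
    let ?t = "\<lambda>i. real_of_int (if i = p then 2 else 0)"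
    have t: "(\<lambda>i j. ?t i * ?t j) \<in> tensor_span d ?M"
      by (rule tensor_span_base[OF fin code_min_vecs_two[OF pq(1) inj]])
    have "E (p, q) = (\<lambda>i j. (1/2) * (?t i * ?t j) + 0 * (?t i * ?t j))"
      unfolding E_def True by (intro ext) auto
    then show ?thesis using tensor_span_lin[OF t t, of "1/2" 0] by simp
  next
    case False
    obtain r s where Q: "is_quad d f p q r s"
      using quad_rich_quad[OF assms pq False, of "{}"] by auto
    then have dist: "distinct [p, q, r, s]" by (simp add: is_quad_def)
    define v where "v = (\<lambda>b c e i. real_of_int (quad_comb p q r s 1 b c e i))"
    have v_in: "(\<lambda>i j. v b c e i * v b c e j) \<in> tensor_span d ?M" if "b \<in> {1, -1}" "c \<in> {1, -1}" "e \<in> {1, -1}" for b c e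
    proof (rule tensor_span_base[OF fin])
      show "v b c e \<in> ?M" unfolding v_def
        by (rule code_min_vecsI[OF is_quad_quad_comb[OF Q] _ inj]) (use that in \<open>auto simp: sum_quad_comb_square[OF Q]\<close>)
    qed
    define x where "x = (\<lambda>l i::nat. if i = l then 1 else 0 :: real)"
    have v_eq: "v b c e i = x p i + real_of_int b * x q i + real_of_int c * x r i + real_of_int e * x s i" for b c e i
      unfolding v_def quad_comb_def x_def using dist by simp
    have E_eq: "E (p, q) i j = x p i * x q j + x q i * x p j" for i j
      by (cases "i = p"; cases "j = q"; cases "i = q"; cases "j = p") (simp_all add: E_def x_def)
    \<comment> \<open>With signs (1, b, c, c), weighting each tensor by b/4 and summing over b and c
      cancels everything except the mixed p, q terms.\<close>
    have "E (p, q) = (\<lambda>i j. 1 * (1/4 * (v 1 1 1 i * v 1 1 1 j) + 1/4 * (v 1 (-1) (-1) i * v 1 (-1) (-1) j))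
        + 1 * ((-1/4) * (v (-1) 1 1 i * v (-1) 1 1 j) + (-1/4) * (v (-1) (-1) (-1) i * v (-1) (-1) (-1) j)))"
      unfolding E_eq v_eq by (intro ext) (simp add: E_eq algebra_simps)
    also have "\<dots> \<in> tensor_span d ?M" by (intro tensor_span_lin v_in) auto
    finally show ?thesis .
  qed
  show ?thesis unfolding perfect_def
  proof (intro allI impI)
    fix S :: "nat \<Rightarrow> nat \<Rightarrow> real" assume S: "\<forall>i<d. \<forall>j<d. S i j = S j i"
    \<comment> \<open>Halved because the ordered pairs (p, q) and (q, p) both contribute.\<close>
    have "(\<lambda>i j. \<Sum>p\<in>{..<d} \<times> {..<d}. (S (fst p) (snd p) / 2) * E p i j) \<in> tensor_span d ?M"
      by (rule tensor_span_sum) (auto simp: E_in)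
    then obtain a where a: "\<And>i j. i < d \<Longrightarrow> j < d \<Longrightarrow>
        (\<Sum>p\<in>{..<d} \<times> {..<d}. (S (fst p) (snd p) / 2) * E p i j) = (\<Sum>v\<in>?M. a v * v i * v j)"
      unfolding tensor_span_def by blast
    have S_eq: "(\<Sum>p\<in>{..<d} \<times> {..<d}. (S (fst p) (snd p) / 2) * E p i j) = S i j" if ij: "i < d" "j < d" for i j
    proof -
      have "(\<Sum>p\<in>{..<d} \<times> {..<d}. (S (fst p) (snd p) / 2) * E p i j)
          = (\<Sum>p<d. \<Sum>q<d. (S p q / 2) * E (p, q) i j)"
        unfolding sum.cartesian_product by (intro sum.cong) auto
      also have "\<dots> = (\<Sum>p<d. \<Sum>q<d. (if q = j then (if p = i then S i j / 2 else 0) else 0)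
          + (if q = i then (if p = j then S j i / 2 else 0) else 0))"
        by (intro sum.cong refl) (auto simp: E_def)
      also have "\<dots> = S i j / 2 + S j i / 2" using ij by (simp add: sum.distrib)
      finally show ?thesis using S ij by simp
    qed
    show "\<exists>a. \<forall>i<d. \<forall>j<d. S i j = (\<Sum>v\<in>?M. a v * v i * v j)"
      by (intro exI[of _ a] allI impI) (rule trans[OF S_eq[symmetric] a])
  qed
qed

lemma code_lattice_prim_integral:
  assumes "quad_rich d f"
  shows "prim_integral d (code_lattice d f)"
proof -
  let ?L = "code_lattice d f" and ?r = "\<lambda>c i. real_of_int (c i :: int)"
  have "ip d x y \<in> \<int>" if "x \<in> ?L" "y \<in> ?L" for x y
    using that by (auto simp: code_lattice_def ip_of_int simp del: of_int_sum of_int_mult)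
  moreover have "Gcd {k::int. \<exists>x\<in>?L. \<exists>y\<in>?L. ip d x y = of_int k} = 1"
  proof -
    have "0 < d" "1 < d" using assms by (auto simp: quad_rich_def)
    then obtain r s where Q: "is_quad d f 0 1 r s" using quad_rich_quad[OF assms, of 0 1 "{}"] by auto
    obtain a b c where Q': "is_quad d f 0 a b c" "a \<notin> {0, 1, r, s}" "b \<notin> {0, 1, r, s}" "c \<notin> {0, 1, r, s}"
      by (rule quad_rich_meet[OF assms Q])
    have "ip d (?r (quad_comb 0 1 r s 1 1 1 1)) (?r (quad_comb 0 a b c 1 1 1 1)) = of_int 1"
      unfolding ip_of_int ip_quads_meet[OF Q Q'] ..
    moreover have "?r (quad_comb 0 1 r s 1 1 1 1) \<in> ?L" "?r (quad_comb 0 a b c 1 1 1 1) \<in> ?L"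
      using is_quad_quad_comb[OF Q] is_quad_quad_comb[OF Q'(1)] by (simp_all add: code_lattice_def)
    ultimately have "1 \<in> {k::int. \<exists>x\<in>?L. \<exists>y\<in>?L. ip d x y = of_int k}" by blast
    then show ?thesis by (rule Gcd_eq_1_I[rotated]) simp
  qed
  ultimately show ?thesis unfolding prim_integral_def by blast
qed

section \<open>Isomorphisms of the constructed lattices\<close>

lemma lattice_iso_refl:
  assumes "\<And>x. x \<in> L \<Longrightarrow> is_vec d x"
  shows "lattice_iso d L L"
proof -
  define U where "U = (\<lambda>i j::nat. if i = j then 1 else 0 :: real)"
  have "(\<Sum>k<d. U k i * U k j) = (if i = j then 1 else 0)" if "i < d" "j < d" for i j
  proof -
    have "(\<Sum>k<d. U k i * U k j) = (\<Sum>k<d. if k = i then U i j else 0)"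
      by (intro sum.cong refl) (simp add: U_def)
    then show ?thesis using that by (simp add: U_def)
  qed
  moreover have "(\<lambda>i. if i < d then (\<Sum>k<d. U i k * x k) else 0) = x" if "x \<in> L" for x
  proof
    fix i
    have "(\<Sum>k<d. U i k * x k) = (\<Sum>k<d. if k = i then x i else 0)"
      by (intro sum.cong refl) (simp add: U_def)
    then show "(if i < d then (\<Sum>k<d. U i k * x k) else 0) = x i"
      using assms[OF that] by (auto simp: is_vec_def)
  qed
  then have "L = (\<lambda>x i. if i < d then (\<Sum>k<d. U i k * x k) else 0) ` L" by simp
  ultimately show ?thesis unfolding lattice_iso_def by blast
qed

text \<open>The vectors \<open>\<plusminus>2e\<^sub>i\<close> are recognizable among the minimal vectors: their inner products with all
  lattice vectors are even.\<close>

lemma code_lattice_iso_frame: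
  assumes f: "quad_rich d f" and f': "quad_rich d f'"
    and U: "\<And>i j. i < d \<Longrightarrow> j < d \<Longrightarrow> (\<Sum>k<d. U k i * U k j) = (if i = j then 1 else 0)"
    and img: "code_lattice d f' = (\<lambda>x i. if i < d then (\<Sum>k<d. U i k * x k) else 0) ` code_lattice d f"
    and i: "i < d"
  shows "\<exists>j<d. \<exists>a\<in>{1, -1::int}. \<forall>k<d. U k i = (if k = j then of_int a else 0)"
proof -
  let ?T = "\<lambda>x i. if i < d then (\<Sum>k<d. U i k * x k) else 0"
  have inj': "inj_on f' {..<d}" using f' by (simp add: quad_rich_def)
  have "(\<lambda>l. real_of_int (if l = i then 2 else 0)) \<in> code_lattice d f"
    using code_vecs_two[OF i] unfolding code_lattice_def by (intro imageI)
  then have "?T (\<lambda>l. real_of_int (if l = i then 2 else 0)) \<in> code_lattice d f'" unfolding img by (rule imageI)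
  then obtain c where c: "c \<in> code_vecs d f'"
    "?T (\<lambda>l. real_of_int (if l = i then 2 else 0)) = (\<lambda>k. real_of_int (c k))"
    unfolding code_lattice_def by blast
  \<comment> \<open>Column \<open>i\<close> of \<open>U\<close> is half the image of 2e_i.\<close>
  have cU: "real_of_int (c k) = 2 * U k i" if "k < d" for k
  proof -
    have "real_of_int (c k) = (\<Sum>l<d. U k l * real_of_int (if l = i then 2 else 0))"
      using fun_cong[OF c(2), of k] that by simp
    also have "\<dots> = (\<Sum>l<d. if l = i then 2 * U k i else 0)" by (intro sum.cong) auto
    finally show ?thesis using i by simp
  qed
  have "real_of_int (\<Sum>k<d. (c k)\<^sup>2) = (\<Sum>k<d. 4 * (U k i * U k i))"
    unfolding of_int_sum by (intro sum.cong refl) (simp add: cU power2_eq_square)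
  also have "\<dots> = 4" using U[OF i i] by (simp add: sum_distrib_left[symmetric])
  finally have norm: "(\<Sum>k<d. (c k)\<^sup>2) = 4" by linarith
  then have nz: "c \<noteq> (\<lambda>_. 0)" by auto
  \<comment> \<open>An isometry preserves inner products, and 2e_i has inner product
    \<open>2 * x i\<close> with the preimage.\<close>
  have even: "even (\<Sum>k<d. c k * y k)" if y: "y \<in> code_vecs d f'" for y
  proof -
    have "(\<lambda>k. real_of_int (y k)) \<in> code_lattice d f'" using y unfolding code_lattice_def by (rule imageI)
    then obtain x where x: "x \<in> code_vecs d f" "(\<lambda>k. real_of_int (y k)) = ?T (\<lambda>k. real_of_int (x k))"
      unfolding img unfolding code_lattice_def by blast
    have "real_of_int (\<Sum>k<d. c k * y k) = (\<Sum>k<d. 2 * U k i * (\<Sum>l<d. U k l * real_of_int (x l)))"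
      unfolding of_int_sum
    proof (intro sum.cong refl)
      fix k assume "k \<in> {..<d}"
      then show "real_of_int (c k * y k) = 2 * U k i * (\<Sum>l<d. U k l * real_of_int (x l))"
        using cU[of k] fun_cong[OF x(2), of k] by simp
    qed
    also have "\<dots> = (\<Sum>k<d. \<Sum>l<d. 2 * real_of_int (x l) * (U k i * U k l))"
      by (simp add: sum_distrib_left mult_ac)
    also have "\<dots> = (\<Sum>l<d. \<Sum>k<d. 2 * real_of_int (x l) * (U k i * U k l))" by (rule sum.swap)
    also have "\<dots> = (\<Sum>l<d. 2 * real_of_int (x l) * (if i = l then 1 else 0))"
      unfolding sum_distrib_left[symmetric] by (intro sum.cong refl) (simp add: U i)
    also have "\<dots> = (\<Sum>l<d. if l = i then 2 * real_of_int (x i) else 0)" by (intro sum.cong) auto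
    also have "\<dots> = real_of_int (2 * x i)" using i by simp
    finally have "(\<Sum>k<d. c k * y k) = 2 * x i" by linarith
    then show ?thesis by simp
  qed
  \<comment> \<open>A second quadruple meeting the first in one index would give inner product
    \<plusminus>1.\<close>
  have "\<not> quad_vec d f' c"
  proof
    assume "quad_vec d f' c"
    then obtain p q r s x y z t where Q: "is_quad d f' p q r s" and x: "x \<in> {1, -1}"
      and ceq: "c = quad_comb p q r s x y z t" unfolding quad_vec_def by blast
    obtain a b b' where Q': "is_quad d f' p a b b'" "a \<notin> {p, q, r, s}" "b \<notin> {p, q, r, s}" "b' \<notin> {p, q, r, s}"
      by (rule quad_rich_meet[OF f' Q])
    have "quad_comb p a b b' 1 1 1 1 \<in> code_vecs d f'" by (rule is_quad_quad_comb[OF Q'(1)]) simp_all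
    from even[OF this] have "even x" unfolding ceq ip_quads_meet[OF Q Q'] .
    then show False using x by auto
  qed
  then obtain j a where j: "j < d" "a \<in> {1, -1}" "c = (\<lambda>i. if i = j then 2 * a else 0)"
    using code_vecs_norm(2)[OF c(1) nz inj' norm] by blast
  have "U k i = (if k = j then of_int a else 0)" if "k < d" for k
    using cU[OF that] unfolding j(3) by (simp split: if_splits)
  then show ?thesis using j(1,2) by blast
qed

text \<open>Each column of \<open>U\<close> has a single entry \<plusminus>1, so \<open>U\<close> is
  a signed permutation. It carries vectors on quadruples to signed ones, and odd signs do not affect
  the parity conditions.\<close>

lemma code_lattice_iso_quads:
  assumes f: "quad_rich d f" and f': "quad_rich d f'"
    and iso: "lattice_iso d (code_lattice d f) (code_lattice d f')"
  obtains \<pi> where "inj_on \<pi> {..<d}" "\<pi> ` {..<d} \<subseteq> {..<d}"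
    "\<forall>p q r s. is_quad d f p q r s \<longrightarrow> f' (\<pi> s) = tri (f' (\<pi> p)) (f' (\<pi> q)) (f' (\<pi> r))"
proof -
  obtain U where U: "\<And>i j. i < d \<Longrightarrow> j < d \<Longrightarrow> (\<Sum>k<d. U k i * U k j) = (if i = j then 1 else 0)"
    and img: "code_lattice d f' = (\<lambda>x i. if i < d then (\<Sum>k<d. U i k * x k) else 0) ` code_lattice d f"
    using iso unfolding lattice_iso_def by blast
  have "\<forall>i\<in>{..<d}. \<exists>ja. fst ja < d \<and> snd ja \<in> {1, -1::int} \<and>
      (\<forall>k<d. U k i = (if k = fst ja then of_int (snd ja) else 0))"
  proof
    fix i assume "i \<in> {..<d}"
    then obtain j a where "j < d" "a \<in> {1, -1::int}" "\<forall>k<d. U k i = (if k = j then of_int a else 0)"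
      using code_lattice_iso_frame[OF f f' U img, of i] by auto
    then show "\<exists>ja. fst ja < d \<and> snd ja \<in> {1, -1::int} \<and>
      (\<forall>k<d. U k i = (if k = fst ja then of_int (snd ja) else 0))" by (intro exI[of _ "(j, a)"]) simp
  qed
  from bchoice[OF this] obtain F where F: "\<forall>i\<in>{..<d}. fst (F i) < d \<and> snd (F i) \<in> {1, -1::int} \<and>
      (\<forall>k<d. U k i = (if k = fst (F i) then of_int (snd (F i)) else 0))" ..
  define \<pi> \<epsilon> where "\<pi> = (\<lambda>i. fst (F i))" and "\<epsilon> = (\<lambda>i. snd (F i))"
  have \<pi>: "\<pi> i < d" and \<epsilon>: "\<epsilon> i = 1 \<or> \<epsilon> i = -1"
    and col: "\<And>k. k < d \<Longrightarrow> U k i = (if k = \<pi> i then of_int (\<epsilon> i) else 0)" if "i < d" for i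
    using F that by (auto simp: \<pi>_def \<epsilon>_def)
  have inj: "inj_on \<pi> {..<d}"
  proof (rule inj_onI, rule ccontr)
    fix i j assume ij: "i \<in> {..<d}" "j \<in> {..<d}" "\<pi> i = \<pi> j" "i \<noteq> j"
    then have lt: "i < d" "j < d" by auto
    have "(\<Sum>k<d. U k i * U k j) = (\<Sum>k<d. if k = \<pi> j then of_int (\<epsilon> i * \<epsilon> j) else 0)"
      using ij(3) by (intro sum.cong refl) (simp add: col lt)
    also have "\<dots> = of_int (\<epsilon> i * \<epsilon> j)" using \<pi>[OF lt(2)] by simp
    finally have "of_int (\<epsilon> i * \<epsilon> j) = (0::real)" using U[OF lt] ij(4) by simp
    then show False using \<epsilon>[OF lt(1)] \<epsilon>[OF lt(2)] by auto
  qed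
  have "f' (\<pi> s) = tri (f' (\<pi> p)) (f' (\<pi> q)) (f' (\<pi> r))" if Q: "is_quad d f p q r s" for p q r s
  proof -
    have lt: "p < d" "q < d" "r < d" "s < d" and dist: "distinct [p, q, r, s]"
      using Q by (auto simp: is_quad_def)
    have dist': "distinct [\<pi> p, \<pi> q, \<pi> r, \<pi> s]" using dist lt inj by (auto simp: inj_on_def)
    have odd: "odd (\<epsilon> i)" if "i < d" for i using \<epsilon>[OF that] by auto
    let ?x = "quad_comb p q r s 1 1 1 1" and ?y = "quad_comb (\<pi> p) (\<pi> q) (\<pi> r) (\<pi> s) (\<epsilon> p) (\<epsilon> q) (\<epsilon> r) (\<epsilon> s)"
    have "(\<lambda>i. real_of_int (?x i)) \<in> code_lattice d f"
      unfolding code_lattice_def by (intro imageI is_quad_quad_comb[OF Q]) simp_all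
    then have "(\<lambda>k. if k < d then (\<Sum>l<d. U k l * real_of_int (?x l)) else 0) \<in> code_lattice d f'"
      unfolding img by (rule imageI)
    moreover have "(\<lambda>k. if k < d then (\<Sum>l<d. U k l * real_of_int (?x l)) else 0) = (\<lambda>k. real_of_int (?y k))"
    proof
      fix k
      show "(if k < d then (\<Sum>l<d. U k l * real_of_int (?x l)) else 0) = real_of_int (?y k)"
      proof (cases "k < d")
        case True
        have "(\<Sum>l<d. U k l * real_of_int (?x l)) = U k p + U k q + U k r + U k s"
          using sum_quad_comb[OF dist lt, of "\<lambda>l. U k l" 1 1 1 1] by simp
        also have "\<dots> = real_of_int (?y k)"
          unfolding col[OF lt(1) True] col[OF lt(2) True] col[OF lt(3) True] col[OF lt(4) True] quad_comb_def
          using dist' by simp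
        finally show ?thesis using True by simp
      next
        case False
        then have "k \<noteq> \<pi> p" "k \<noteq> \<pi> q" "k \<noteq> \<pi> r" "k \<noteq> \<pi> s" using \<pi> lt by auto
        then show ?thesis using False by (simp add: quad_comb_def)
      qed
    qed
    ultimately have "(\<lambda>k. real_of_int (?y k)) \<in> code_lattice d f'" by simp
    then obtain c where c: "c \<in> code_vecs d f'" "(\<lambda>k. real_of_int (?y k)) = (\<lambda>k. real_of_int (c k))"
      unfolding code_lattice_def by blast
    have "?y = c" using fun_cong[OF c(2)] by (intro ext) simp
    then have "?y \<in> code_vecs d f'" using c(1) by simp
    then show ?thesis using quad_comb_in_code_vecs_iff[OF dist' \<pi>[OF lt(1)] \<pi>[OF lt(2)] \<pi>[OF lt(3)] \<pi>[OF lt(4)]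
          odd[OF lt(1)] odd[OF lt(2)] odd[OF lt(3)] odd[OF lt(4)]] by blast
  qed
  moreover have "\<pi> ` {..<d} \<subseteq> {..<d}" using \<pi> by blast
  ultimately show thesis using that[of \<pi>] inj by blast
qed

section \<open>Counting point sets\<close>

lemma tri_degenerate [simp]: "tri a a b = b" "tri a b a = b" "tri b a a = b"
  unfolding tri_def by blast+

lemma tri_eq_iff: "tri a b c = a \<longleftrightarrow> b = c" "tri a b c = b \<longleftrightarrow> a = c" "tri a b c = c \<longleftrightarrow> a = b"
  unfolding tri_def by blast+

text \<open>For \<open>n \<ge> 8\<close> this is the union of two subspaces of codimension 4, hence
  at most 1/8 of F_2^n. Since their sum is the whole space, every a + b splits into a point from
  each.\<close>

definition core_points :: "nat \<Rightarrow> nat set set" where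
  "core_points n = {X. X \<subseteq> {..<n} \<and> (X \<inter> {..<4} = {} \<or> X \<inter> {4..<8} = {})}"

definition point_sets :: "nat \<Rightarrow> nat \<Rightarrow> nat set set set" where
  "point_sets n d = {S. core_points n \<subseteq> S \<and> S \<subseteq> Pow {..<n} \<and> card S = d}"

text \<open>For every \<open>k \<ge> 8\<close>, the point \<open>c\<close> that is the sum of \<open>a\<close> and \<open>b\<close> on \<open>{4..<8}\<close>, \<open>{k}\<close> on \<open>{8..<n}\<close>, and
  zero on \<open>{..<4}\<close> works unless it is excluded by \<open>F\<close>; there are more values of \<open>k\<close> than exclusions.\<close>

lemma core_points_cover:
  assumes n: "n \<ge> 19" and ab: "a \<subseteq> {..<n}" "b \<subseteq> {..<n}" and F: "finite F" "card F \<le> 5"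
  shows "\<exists>c\<in>core_points n. tri a b c \<in> core_points n \<and> c \<notin> F \<and> tri a b c \<notin> F"
proof -
  define c where "c = (\<lambda>k. insert k {j \<in> {4..<8}. (j \<in> a) \<noteq> (j \<in> b)})"
  let ?K = "{8..<n}"
  have inj1: "inj_on c {k \<in> ?K. c k \<in> F}"
    by (rule inj_onI) (auto simp: c_def)
  have "tri a b (tri a b x) = x" for x unfolding tri_def by blast
  then have inj2: "inj_on (\<lambda>k. tri a b (c k)) {k \<in> ?K. tri a b (c k) \<in> F}"
  proof (intro inj_onI)
    fix x y assume "x \<in> {k \<in> ?K. tri a b (c k) \<in> F}" "y \<in> {k \<in> ?K. tri a b (c k) \<in> F}"
      \<comment> \<open>Adding a + b is an involution, hence injective.\<close>
      "tri a b (c x) = tri a b (c y)" and inv: "\<And>x. tri a b (tri a b x) = x"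
    then have "c x = c y" "8 \<le> x" "8 \<le> y" by (metis, auto)
    then show "x = y" by (auto simp: c_def)
  qed
  have "card {k \<in> ?K. c k \<in> F} \<le> card F" by (rule card_inj_on_le[OF inj1 _ F(1)]) blast
  moreover have "card {k \<in> ?K. tri a b (c k) \<in> F} \<le> card F" by (rule card_inj_on_le[OF inj2 _ F(1)]) blast
  ultimately have "card ({k \<in> ?K. c k \<in> F} \<union> {k \<in> ?K. tri a b (c k) \<in> F}) \<le> 10"
    using card_Un_le[of "{k \<in> ?K. c k \<in> F}" "{k \<in> ?K. tri a b (c k) \<in> F}"] F(2) by linarith
  \<comment> \<open>Here 19 = 8 + 11: each of the two points excludes at most 5 values of
    \<open>k\<close>, so 11 candidates suffice.\<close>
  moreover have "card ?K \<ge> 11" using n by simp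
  ultimately have "\<not> ?K \<subseteq> {k \<in> ?K. c k \<in> F} \<union> {k \<in> ?K. tri a b (c k) \<in> F}"
    using card_mono[of "{k \<in> ?K. c k \<in> F} \<union> {k \<in> ?K. tri a b (c k) \<in> F}" ?K] by fastforce
  then obtain k where "k \<in> ?K" and kF: "c k \<notin> F" "tri a b (c k) \<notin> F" by blast
  then have k: "8 \<le> k" "k < n" by auto
  have "c k \<subseteq> {..<n}" "c k \<inter> {..<4} = {}" using k(1,2) by (auto simp: c_def)
  then have "c k \<in> core_points n" by (simp add: core_points_def)
  moreover have "tri a b (c k) \<in> core_points n"
  proof -
    \<comment> \<open>On \<open>{4..<8}\<close> the point \<open>c k\<close> equals a + b, so the
      triple sum vanishes there.\<close>
    have "tri a b (c k) \<inter> {4..<8} = {}" using k(1) by (auto simp: tri_def c_def)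
    moreover have "tri a b (c k) \<subseteq> {..<n}"
      using ab \<open>c k \<subseteq> {..<n}\<close> unfolding tri_def by blast
    ultimately show ?thesis by (simp add: core_points_def)
  qed
  ultimately show ?thesis using kF by blast
qed

lemma point_sets_quad_rich:
  assumes "n \<ge> 19" "S \<in> point_sets n d" "bij_betw f {..<d} S" "d \<ge> 5"
  shows "quad_rich d f"
proof -
  have S: "core_points n \<subseteq> S" "S \<subseteq> Pow {..<n}" using assms(2) by (auto simp: point_sets_def)
  have inj: "inj_on f {..<d}" and img: "f ` {..<d} = S" using assms(3) by (auto simp: bij_betw_def)
  have "\<exists>r<d. \<exists>s<d. r \<notin> F \<and> s \<notin> F \<and> f s = tri (f p) (f q) (f r)"
    if "p < d" "q < d" "finite F" "card F \<le> 5" for p q F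
  proof -
    have sub: "f p \<subseteq> {..<n}" "f q \<subseteq> {..<n}" using that(1,2) img S(2) by auto
    have "finite (f ` F)" "card (f ` F) \<le> 5"
      using that(3,4) card_image_le[OF that(3), of f] by auto
    then obtain c where c: "c \<in> core_points n" "tri (f p) (f q) c \<in> core_points n"
      "c \<notin> f ` F" "tri (f p) (f q) c \<notin> f ` F"
      using core_points_cover[OF assms(1) sub, of "f ` F"] by auto
    then have "c \<in> f ` {..<d}" "tri (f p) (f q) c \<in> f ` {..<d}" using S(1) img by auto
    then obtain r s where "r < d" "s < d" "c = f r" "tri (f p) (f q) c = f s" by blast
    then show ?thesis using c(3,4) by (intro exI[of _ r] conjI exI[of _ s]) auto
  qed
  then show ?thesis using inj assms(4) unfolding quad_rich_def by blast
qed

section \<open>Rigidity of maps that respect sums of three points\<close>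

definition tri_hom :: "nat set set \<Rightarrow> (nat set \<Rightarrow> nat set) \<Rightarrow> bool" where
  "tri_hom S \<phi> \<longleftrightarrow> (\<forall>a\<in>S. \<forall>b\<in>S. \<forall>c\<in>S. tri a b c \<in> S \<longrightarrow> \<phi> (tri a b c) = tri (\<phi> a) (\<phi> b) (\<phi> c))"

definition affine_frame :: "nat \<Rightarrow> nat set set" where
  "affine_frame n = insert {} ((\<lambda>k. {k}) ` {..<n})"

text \<open>\<open>S\<close> need not be closed under sums, so every intermediate point must lie in
  it. The core contains all subsets of its members and is reached one coordinate at a time; any
  other point is a sum of two core points and the origin.\<close>

lemma tri_hom_eqI:
  assumes S: "core_points n \<subseteq> S" "S \<subseteq> Pow {..<n}" and hom: "tri_hom S \<phi>" "tri_hom S \<psi>"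
    and eq: "\<And>x. x \<in> affine_frame n \<Longrightarrow> \<phi> x = \<psi> x" and "s \<in> S"
  shows "\<phi> s = \<psi> s"
proof -
  have step: "\<phi> (tri a b c) = \<psi> (tri a b c)"
    if "a \<in> S" "b \<in> S" "c \<in> S" "tri a b c \<in> S" "\<phi> a = \<psi> a" "\<phi> b = \<psi> b" "\<phi> c = \<psi> c" for a b c
    using hom that unfolding tri_hom_def by metis
  have empty: "{} \<in> S" "\<phi> {} = \<psi> {}" using S(1) eq by (auto simp: core_points_def affine_frame_def)
  have single: "{k} \<in> S" "\<phi> {k} = \<psi> {k}" if "k < n" for k
    using S(1) eq[of "{k}"] that by (auto simp: core_points_def affine_frame_def)
  have core: "\<phi> X = \<psi> X" if "X \<in> core_points n" for X
  proof -
    have "finite X" using that finite_subset[of X "{..<n}"] by (auto simp: core_points_def)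
    then show ?thesis using that
    proof (induction X rule: finite_induct)
      case empty
      show ?case by (rule \<open>\<phi> {} = \<psi> {}\<close>)
    next
      case (insert k X)
      have X: "X \<in> core_points n" and k: "k < n" using insert.prems by (auto simp: core_points_def)
      have "insert k X = tri X {k} {}" using insert.hyps unfolding tri_def by auto
      moreover have "X \<in> S" "insert k X \<in> S" using S(1) X insert.prems by blast+
      ultimately have "\<phi> (tri X {k} {}) = \<psi> (tri X {k} {})"
        using insert.IH[OF X] single[OF k] empty by (intro step) simp_all
      then show ?case using \<open>insert k X = tri X {k} {}\<close> by simp
    qed
  qed
  have "s - {..<4} \<in> core_points n" "s \<inter> {..<4} \<in> core_points n"
    using assms(6) S(2) by (auto simp: core_points_def)
  moreover have "s = tri (s - {..<4}) (s \<inter> {..<4}) {}" unfolding tri_def by blast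
  ultimately show ?thesis using step[of "s - {..<4}" "s \<inter> {..<4}" "{}"] core empty S(1) assms(6) by (metis subsetD)
qed

lemma iso_tri_hom:
  assumes f: "quad_rich d f" "bij_betw f {..<d} S" and f': "quad_rich d f'" "bij_betw f' {..<d} S'"
    and iso: "lattice_iso d (code_lattice d f) (code_lattice d f')"
  obtains \<phi> where "tri_hom S \<phi>" "\<phi> ` S = S'"
proof -
  obtain \<pi> where \<pi>: "inj_on \<pi> {..<d}" "\<pi> ` {..<d} \<subseteq> {..<d}"
    "\<forall>p q r s. is_quad d f p q r s \<longrightarrow> f' (\<pi> s) = tri (f' (\<pi> p)) (f' (\<pi> q)) (f' (\<pi> r))"
    by (rule code_lattice_iso_quads[OF f(1) f'(1) iso])
  define \<phi> where "\<phi> = (\<lambda>x. f' (\<pi> (the_inv_into {..<d} f x)))"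
  have inj: "inj_on f {..<d}" and img: "f ` {..<d} = S" using f(2) by (auto simp: bij_betw_def)
  have \<phi>f: "\<phi> (f i) = f' (\<pi> i)" if "i < d" for i
    using that by (simp add: \<phi>_def the_inv_into_f_f[OF inj])
  have "\<pi> ` {..<d} = {..<d}" using \<pi>(1,2) by (simp add: endo_inj_surj)
  then have "\<phi> ` S = f' ` {..<d}"
    unfolding img[symmetric] image_image using \<phi>f by (metis (no_types, lifting) image_cong image_image lessThan_iff)
  then have "\<phi> ` S = S'" using f'(2) by (simp add: bij_betw_def)
  moreover have "tri_hom S \<phi>" unfolding tri_hom_def
  proof (intro ballI impI)
    fix a b c assume abc: "a \<in> S" "b \<in> S" "c \<in> S" "tri a b c \<in> S"
    show "\<phi> (tri a b c) = tri (\<phi> a) (\<phi> b) (\<phi> c)"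
    \<comment> \<open>If two points coincide, the sum is the third one and the identity holds for
      every map; \<open>is_quad\<close> covers only distinct points.\<close>
    proof (cases "a = b \<or> b = c \<or> a = c")
      case True
      then show ?thesis by auto
    next
      case False
      obtain p q r s where pqrs: "p < d" "q < d" "r < d" "s < d" "a = f p" "b = f q" "c = f r" "tri a b c = f s"
        using abc unfolding img[symmetric] by auto
      have "tri a b c \<noteq> a" "tri a b c \<noteq> b" "tri a b c \<noteq> c" using False by (auto simp: tri_eq_iff)
      then have "is_quad d f p q r s" using False pqrs by (auto simp: is_quad_def)
      from \<pi>(3)[rule_format, OF this] show ?thesis using pqrs \<phi>f by metis
    qed
  qed
  ultimately show thesis using that by blast
qed

lemma card_affine_frame: "finite (affine_frame n)" "card (affine_frame n) = n + 1"
proof -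
  have "inj_on (\<lambda>k::nat. {k}) {..<n}" by (rule inj_onI) simp
  then have "card ((\<lambda>k. {k}) ` {..<n}) = n" by (simp add: card_image)
  then show "finite (affine_frame n)" "card (affine_frame n) = n + 1"
    unfolding affine_frame_def by (auto simp: card_insert_if)
qed

text \<open>\<open>S'\<close> is recovered as the image of \<open>S\<close> under a map determined
  on \<open>n + 1\<close> frame points, each sent to one of \<open>2 ^ n\<close> points.\<close>

lemma card_iso_point_sets:
  assumes n: "n \<ge> 19" "d \<ge> 5" and f: "\<And>S. S \<in> point_sets n d \<Longrightarrow> bij_betw (f S) {..<d} S"
    and S: "S \<in> point_sets n d"
  shows "card {S' \<in> point_sets n d. lattice_iso d (code_lattice d (f S)) (code_lattice d (f S'))} \<le> (2 ^ n) ^ (n + 1)"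
    (is "card ?A \<le> _")
proof -
  have "\<exists>\<phi>. tri_hom S \<phi> \<and> \<phi> ` S = S'" if "S' \<in> ?A" for S'
  proof -
    have S': "S' \<in> point_sets n d" "lattice_iso d (code_lattice d (f S)) (code_lattice d (f S'))"
      using that by auto
    obtain \<phi> where "tri_hom S \<phi>" "\<phi> ` S = S'"
      by (rule iso_tri_hom[OF point_sets_quad_rich[OF n(1) S f[OF S] n(2)] f[OF S]
            point_sets_quad_rich[OF n(1) S'(1) f[OF S'(1)] n(2)] f[OF S'(1)] S'(2)])
    then show ?thesis by blast
  qed
  then have "\<forall>S'\<in>?A. \<exists>\<phi>. tri_hom S \<phi> \<and> \<phi> ` S = S'" by blast
  from bchoice[OF this] obtain \<Phi> where \<Phi>: "\<forall>S'\<in>?A. tri_hom S (\<Phi> S') \<and> \<Phi> S' ` S = S'" ..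
  let ?h = "\<lambda>S'. restrict (\<Phi> S') (affine_frame n)" and ?P = "affine_frame n \<rightarrow>\<^sub>E Pow {..<n}"
  have core: "core_points n \<subseteq> S" "S \<subseteq> Pow {..<n}" using S by (auto simp: point_sets_def)
  have frame: "affine_frame n \<subseteq> core_points n" by (auto simp: affine_frame_def core_points_def)
  have "inj_on ?h ?A"
  proof (rule inj_onI)
    fix X Y assume XY: "X \<in> ?A" "Y \<in> ?A" "?h X = ?h Y"
    have "\<Phi> X s = \<Phi> Y s" if "s \<in> S" for s
    proof (rule tri_hom_eqI[OF core _ _ _ that])
      show "tri_hom S (\<Phi> X)" "tri_hom S (\<Phi> Y)" using \<Phi> XY by blast+
      show "\<Phi> X x = \<Phi> Y x" if "x \<in> affine_frame n" for x
        using fun_cong[OF XY(3), of x] that by simp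
    qed
    then have "\<Phi> X ` S = \<Phi> Y ` S" by (intro image_cong refl)
    moreover have "\<Phi> X ` S = X" "\<Phi> Y ` S = Y" using \<Phi> XY(1,2) by blast+
    ultimately show "X = Y" by simp
  qed
  moreover have "?h ` ?A \<subseteq> ?P"
  proof (rule image_subsetI)
    fix X assume X: "X \<in> ?A"
    have "\<Phi> X x \<subseteq> {..<n}" if "x \<in> affine_frame n" for x
    proof -
      have "\<Phi> X x \<in> \<Phi> X ` S" using that frame core(1) by blast
      then have "\<Phi> X x \<in> X" using \<Phi> X by blast
      then show ?thesis using X by (auto simp: point_sets_def)
    qed
    then show "?h X \<in> ?P" by auto
  qed
  moreover have "finite ?P" using card_affine_frame(1) by (intro finite_PiE) auto
  ultimately have "card ?A \<le> card ?P" by (rule card_inj_on_le)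
  also have "card ?P = (2 ^ n) ^ (n + 1)"
    using card_affine_frame[of n] by (simp add: card_PiE card_Pow)
  finally show ?thesis .
qed

lemma card_core_points:
  assumes "n \<ge> 8"
  shows "8 * card (core_points n) \<le> 2 ^ n"
proof -
  let ?A = "Pow {4..<n}" and ?B = "Pow ({..<4} \<union> {8..<n})"
  have "core_points n \<subseteq> ?A \<union> ?B"
  proof
    fix X assume X: "X \<in> core_points n"
    show "X \<in> ?A \<union> ?B"
    proof (cases "X \<inter> {..<4} = {}")
      case True
      then have "X \<subseteq> {4..<n}" using X by (fastforce simp: core_points_def not_less)
      then show ?thesis by blast
    next
      case False
      then have "X \<subseteq> {..<4} \<union> {8..<n}" using X by (fastforce simp: core_points_def not_less)
      then show ?thesis by blast
    qed
  qed
  then have "card (core_points n) \<le> card (?A \<union> ?B)" by (intro card_mono) auto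
  also have "\<dots> \<le> card ?A + card ?B" by (rule card_Un_le)
  also have "card ?A = 2 ^ (n - 4)" by (simp add: card_Pow)
  also have "card ?B = 2 ^ (n - 4)"
  proof -
    have "card ({..<4} \<union> {8..<n}) = card {..<4::nat} + card {8..<n}" by (intro card_Un_disjoint) auto
    then show ?thesis using assms by (simp add: card_Pow)
  qed
  finally have "card (core_points n) \<le> 2 * 2 ^ (n - 4)" by simp
  moreover have "(2::nat) ^ n = 16 * 2 ^ (n - 4)"
    using power_add[of "2::nat" 4 "n - 4"] assms by simp
  ultimately show ?thesis by simp
qed

section \<open>Number of point sets and the lower bound\<close>

text \<open>With t core points and 2t <= d, the other d - t are chosen from at least twice as many,
  giving at least 2^(d-t) sets by the bound (N/k)^k on binomials. Squaring avoids halving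
  \<open>d\<close>.\<close>

lemma card_point_sets:
  assumes "n \<ge> 8" "2 * d \<le> 2 ^ n" "2 ^ n \<le> 4 * d"
  shows "finite (point_sets n d)" "2 ^ d \<le> (card (point_sets n d))\<^sup>2"
proof -
  let ?T = "core_points n" and ?P = "Pow {..<n}"
  define t where "t = card ?T"
  have t: "2 * t \<le> d" using card_core_points[OF assms(1)] assms(3) unfolding t_def by linarith
  have TP: "?T \<subseteq> ?P" by (auto simp: core_points_def)
  then have finT: "finite ?T" using finite_subset by blast
  show fin: "finite (point_sets n d)"
    by (rule finite_subset[of _ "Pow ?P"]) (auto simp: point_sets_def)
  let ?R = "{R. R \<subseteq> ?P - ?T \<and> card R = d - t}"
  have "inj_on (\<lambda>R. ?T \<union> R) ?R" by (rule inj_onI) blast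
  moreover have "(\<lambda>R. ?T \<union> R) ` ?R \<subseteq> point_sets n d"
  proof (rule image_subsetI)
    fix R assume R: "R \<in> ?R"
    then have "finite R" using finite_subset[of R ?P] by auto
    then have "card (?T \<union> R) = t + (d - t)" using R finT by (subst card_Un_disjoint) (auto simp: t_def)
    then show "?T \<union> R \<in> point_sets n d" using R TP t by (auto simp: point_sets_def)
  qed
  ultimately have "card ?R \<le> card (point_sets n d)" by (rule card_inj_on_le) (rule fin)
  moreover have "card ?R = (2 ^ n - t) choose (d - t)"
    using n_subsets[of "?P - ?T" "d - t"] TP finT by (simp add: card_Diff_subset card_Pow t_def)
  moreover have "2 ^ (d - t) \<le> (2 ^ n - t) choose (d - t)"
  proof (cases "d - t = 0")
    case False
    have le: "2 * (d - t) \<le> 2 ^ n - t" using assms(2) t by linarith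
    have "(2::real) ^ (d - t) \<le> (real (2 ^ n - t) / real (d - t)) ^ (d - t)"
    proof (rule power_mono)
      have "2 * real (d - t) \<le> real (2 ^ n - t)" using le by (metis of_nat_le_iff of_nat_mult of_nat_numeral)
      moreover have "0 < real (d - t)" using False by (simp only: of_nat_0_less_iff neq0_conv)
      ultimately show "2 \<le> real (2 ^ n - t) / real (d - t)" by (simp only: pos_le_divide_eq)
    qed simp
    also have "\<dots> \<le> real ((2 ^ n - t) choose (d - t))"
      using le by (intro binomial_ge_n_over_k_pow_k) simp
    finally have "real (2 ^ (d - t)) \<le> real ((2 ^ n - t) choose (d - t))" by simp
    then show ?thesis by (simp only: of_nat_le_iff)
  qed simp
  ultimately have "2 ^ (d - t) \<le> card (point_sets n d)" by simp
  then have "(2 ^ (d - t))\<^sup>2 \<le> (card (point_sets n d))\<^sup>2" by (rule power_mono) simp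
  moreover have "(2::nat) ^ d \<le> (2 ^ (d - t))\<^sup>2"
    unfolding power_mult[symmetric] using t by (intro power_increasing) auto
  ultimately show "2 ^ d \<le> (card (point_sets n d))\<^sup>2" by (rule order_trans[rotated])
qed

lemma card_le_fibers:
  assumes "finite A" "\<And>x. x \<in> A \<Longrightarrow> card {y \<in> A. h y = h x} \<le> k"
  shows "card A \<le> k * card (h ` A)"
proof -
  have "A = (\<Union>z\<in>h ` A. {y \<in> A. h y = z})" by blast
  then have "card A \<le> (\<Sum>z\<in>h ` A. card {y \<in> A. h y = z})"
    using card_UN_le[of "h ` A" "\<lambda>z. {y \<in> A. h y = z}"] assms(1) by simp
  also have "\<dots> \<le> (\<Sum>z\<in>h ` A. k)" using assms(2) by (intro sum_mono) auto
  finally show ?thesis by (simp add: mult.commute)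
qed

lemma p_count_lower:
  assumes fin: "finite (perfect_prim_lattices d // {(L, L'). L \<in> perfect_prim_lattices d \<and>
      L' \<in> perfect_prim_lattices d \<and> lattice_iso d L L'})"
    and n: "n \<ge> 19" "2 * d \<le> 2 ^ n" "2 ^ n \<le> 4 * d"
  shows "2 ^ d \<le> ((2 ^ n) ^ (n + 1) * p_count d)\<^sup>2"
proof -
  define r where "r = {(L, L'). L \<in> perfect_prim_lattices d \<and> L' \<in> perfect_prim_lattices d \<and> lattice_iso d L L'}"
  let ?F = "point_sets n d"
  have "(2::nat) ^ 19 \<le> 2 ^ n" using n(1) by (intro power_increasing) auto
  then have d: "d \<ge> 5" using n(3) by simp
  have "\<exists>f. bij_betw f {..<d} S" if "S \<in> ?F" for S
  proof -
    have "finite S" "card S = d" using that finite_subset[of S "Pow {..<n}"] by (auto simp: point_sets_def)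
    then show ?thesis using ex_bij_betw_nat_finite[of S] by (auto simp: lessThan_atLeast0)
  qed
  then have "\<forall>S\<in>?F. \<exists>f. bij_betw f {..<d} S" by blast
  from bchoice[OF this] obtain f where f: "\<forall>S\<in>?F. bij_betw (f S) {..<d} S" ..
  let ?L = "\<lambda>S. code_lattice d (f S)"
  have L: "?L S \<in> perfect_prim_lattices d" if "S \<in> ?F" for S
  proof -
    have "quad_rich d (f S)" using point_sets_quad_rich[OF n(1) that _ d] f that by blast
    then show ?thesis unfolding perfect_prim_lattices_def
      using code_lattice_is_lattice code_lattice_perfect code_lattice_prim_integral by blast
  qed
  define h where "h = (\<lambda>S. r `` {?L S})"
  have "card ?F \<le> (2 ^ n) ^ (n + 1) * card (h ` ?F)"
  proof (rule card_le_fibers)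
    show "finite ?F" using card_point_sets(1)[of n d] n by simp
    fix S assume S: "S \<in> ?F"
    \<comment> \<open>By reflexivity \<open>?L S'\<close> lies in its own class, so equal classes
      yield an isometry from \<open>?L S\<close>.\<close>
    have "{S' \<in> ?F. h S' = h S} \<subseteq> {S' \<in> ?F. lattice_iso d (?L S) (?L S')}"
    proof
      fix S' assume S': "S' \<in> {S' \<in> ?F. h S' = h S}"
      have "lattice_iso d (?L S') (?L S')"
        by (rule lattice_iso_refl) (auto simp: code_lattice_def code_vecs_def is_vec_def)
      then have "?L S' \<in> h S'" using L S' by (simp add: h_def r_def)
      then have "?L S' \<in> h S" using S' by simp
      then show "S' \<in> {S' \<in> ?F. lattice_iso d (?L S) (?L S')}" using S' by (simp add: h_def r_def)
    qed
    then have "card {S' \<in> ?F. h S' = h S} \<le> card {S' \<in> ?F. lattice_iso d (?L S) (?L S')}"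
      using \<open>finite ?F\<close> by (intro card_mono) auto
    also have "\<dots> \<le> (2 ^ n) ^ (n + 1)"
      using card_iso_point_sets[OF n(1) d _ S, of f] f by blast
    finally show "card {S' \<in> ?F. h S' = h S} \<le> (2 ^ n) ^ (n + 1)" .
  qed
  also have "card (h ` ?F) \<le> p_count d"
    unfolding p_count_def r_def[symmetric]
  proof (rule card_mono)
    show "finite (perfect_prim_lattices d // r)" using fin by (simp add: r_def)
    show "h ` ?F \<subseteq> perfect_prim_lattices d // r" using L by (auto simp: h_def intro: quotientI)
  qed
  finally have "card ?F \<le> (2 ^ n) ^ (n + 1) * p_count d" by simp
  then have "(card ?F)\<^sup>2 \<le> ((2 ^ n) ^ (n + 1) * p_count d)\<^sup>2" by (rule power_mono) simp
  then show ?thesis using card_point_sets(2)[of n d] n by linarith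
qed

section \<open>Asymptotic estimates\<close>

lemma upper_asymptotics:
  assumes "\<epsilon> > (0::real)"
  shows "eventually (\<lambda>d::nat. 3 * real d ^ 3 * ln (2 * real d + 3) < real d powr (3 + \<epsilon>)) sequentially"
  using assms by real_asymp

lemma lower_asymptotics:
  assumes "\<epsilon> > (0::real)"
  shows "eventually (\<lambda>d::nat. real d powr (1 - \<epsilon>) <
    real d * ln 2 / 2 - ln (4 * real d) * (ln (4 * real d) / ln 2 + 1)) sequentially"
  using assms by real_asymp

lemma p_count_upper_exp:
  assumes "d > 0"
  shows "real (p_count d) \<le> exp (3 * real d ^ 3 * ln (2 * real d + 3))"
proof -
  have "p_count d \<le> (2 * d + 3) ^ (3 * d ^ 3)"
    unfolding p_count_def using perfect_classes_bound[OF assms] by blast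
  then have "real (p_count d) \<le> real ((2 * d + 3) ^ (3 * d ^ 3))" by (simp only: of_nat_le_iff)
  also have "\<dots> = (2 * real d + 3) ^ (3 * d ^ 3)" by simp
  also have "\<dots> = exp (ln (2 * real d + 3)) ^ (3 * d ^ 3)" by simp
  also have "\<dots> = exp (real (3 * d ^ 3) * ln (2 * real d + 3))" by (rule exp_of_nat_mult[symmetric])
  finally show ?thesis by simp
qed

text \<open>The exponent is the logarithm of 2^(d/2) minus a bound for that of (2^n)^(n+1), using
  2^n <= 4d. The threshold \<open>2 ^ 18\<close> gives 2^n >= 2^19, the dimension required for the
  core.\<close>

lemma p_count_lower_exp:
  assumes "d \<ge> 2 ^ 18"
  shows "exp (real d * ln 2 / 2 - ln (4 * real d) * (ln (4 * real d) / ln 2 + 1)) \<le> real (p_count d)"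
proof -
  \<comment> \<open>The first power of two above \<open>2 * d - 1\<close> is at least
    \<open>2 * d\<close> and at most twice \<open>2 * d - 1\<close>.\<close>
  have "1 \<le> 2 * d - 1" using assms by simp
  from ex_power_ivl1[OF order_refl this]
  obtain n0 where n0: "2 ^ n0 \<le> 2 * d - 1" "2 * d - 1 < 2 ^ (n0 + 1)" by blast
  define n where "n = n0 + 1"
  have n: "2 * d \<le> 2 ^ n" "2 ^ n \<le> 4 * d" using n0 by (simp_all add: n_def)
  have "(2::nat) ^ 19 \<le> 2 ^ n" using n(1) assms by simp
  then have n19: "n \<ge> 19" by (simp only: power_increasing_iff[of "2::nat"])
  have d: "d > 0" using assms by (simp add: Suc_le_eq less_le_trans[of 0 "2^18"])
  have "2 ^ d \<le> ((2 ^ n) ^ (n + 1) * p_count d)\<^sup>2"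
    using p_count_lower[OF _ n19 n] perfect_classes_bound[OF d] by blast
  then have "real (2 ^ d) \<le> real (((2 ^ n) ^ (n + 1) * p_count d)\<^sup>2)" by (simp only: of_nat_le_iff)
  then have main: "(2::real) ^ d \<le> (2 ^ (n * (n + 1)) * real (p_count d))\<^sup>2" by (simp add: power_mult power_add)
  have exp2: "(2::real) ^ k = exp (real k * ln 2)" for k
    by (simp add: exp_of_nat_mult)
  have square: "(exp (real d * ln 2 / 2))\<^sup>2 = (2::real) ^ d"
    unfolding exp2 by (simp add: power2_eq_square exp_add[symmetric])
  have "exp (real d * ln 2 / 2) \<le> 2 ^ (n * (n + 1)) * real (p_count d)"
    by (rule power2_le_imp_le[OF main[folded square]]) (intro mult_nonneg_nonneg, simp_all)
  also have "\<dots> \<le> exp (ln (4 * real d) * (ln (4 * real d) / ln 2 + 1)) * real (p_count d)"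
  proof (rule mult_right_mono)
    have "real (2 ^ n) \<le> real (4 * d)" using n(2) by (simp only: of_nat_le_iff)
    then have "exp (real n * ln 2) \<le> 4 * real d" using exp2[of n] by simp
    then have le: "real n * ln 2 \<le> ln (4 * real d)" using d by (simp add: ln_ge_iff)
    then have "real n \<le> ln (4 * real d) / ln 2" by (simp add: pos_le_divide_eq)
    then have "(real n * ln 2) * (real n + 1) \<le> ln (4 * real d) * (ln (4 * real d) / ln 2 + 1)"
      using le by (intro mult_mono) (auto intro: order_trans[of 0 "real n * ln 2"])
    then show "2 ^ (n * (n + 1)) \<le> exp (ln (4 * real d) * (ln (4 * real d) / ln 2 + 1))"
      unfolding exp2 by (simp add: algebra_simps)
  qed simp
  finally show ?thesis by (simp add: exp_diff pos_divide_le_eq mult.commute)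
qed

theorem theorem1p1:
  shows "\<forall>\<epsilon>::real. \<epsilon> > 0 \<longrightarrow> (\<exists>N::nat. \<forall>d\<ge>N.
     exp (real d powr (1 - \<epsilon>)) < real (p_count d) \<and>
     real (p_count d) < exp (real d powr (3 + \<epsilon>)))"
proof (intro allI impI)
  fix \<epsilon> :: real assume \<epsilon>: "\<epsilon> > 0"
  have "eventually (\<lambda>d::nat. exp (real d powr (1 - \<epsilon>)) < real (p_count d) \<and>
     real (p_count d) < exp (real d powr (3 + \<epsilon>))) sequentially"
    using upper_asymptotics[OF \<epsilon>] lower_asymptotics[OF \<epsilon>] eventually_ge_at_top[of "2 ^ 18"]
  proof eventually_elim
    case (elim d)
    have "d > 0" using elim(3) by (rule less_le_trans[rotated]) simp
    show ?case
    proof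
      show "exp (real d powr (1 - \<epsilon>)) < real (p_count d)"
        using elim(2) p_count_lower_exp[OF elim(3)] by (meson exp_less_cancel_iff less_le_trans)
      show "real (p_count d) < exp (real d powr (3 + \<epsilon>))"
        using elim(1) p_count_upper_exp[OF \<open>d > 0\<close>] by (meson exp_less_cancel_iff le_less_trans)
    qed
  qed
  then show "\<exists>N::nat. \<forall>d\<ge>N. exp (real d powr (1 - \<epsilon>)) < real (p_count d) \<and>
     real (p_count d) < exp (real d powr (3 + \<epsilon>))"
    unfolding eventually_sequentially .
qed

end
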